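(* Let $(\mathcal{N}\cup\{0\},\mathcal{E})$ be a radial distribution network with net nodal consumptions $(p_i,q_i)_{i\in\mathcal{N}}$ satisfying the No Reverse Power Flow (NRPF) condition. Let $k,l\in\mathcal{N}$ with $k\prec l$ (i.e. $k$ is upstream of $l$), and let $\mathcal{Z}_{kl}=\{(p_k,p_l),(q_k,q_l)\}$. Then the impact of a change in net nodal consumption at $l$ on the flow and voltage quantities is larger than that due to an equivalent change in net consumption at $k$, i.e., for nonlinear power flow (NPF), $$\frac{\partial f}{\partial c_l}>\frac{\partial f}{\partial c_k}>0>\frac{\partial v}{\partial c_k}>\frac{\partial v}{\partial c_l}\qquad\forall\, f\in\mathcal{F},\ v\in\mathcal{V},\ (c_k,c_l)\in\mathcal{Z}_{kl},$$ and for linear power flow (LPF), $$\frac{\partial \hat f}{\partial c_l}\ge\frac{\partial \hat f}{\partial c_k}\ge0>\frac{\partial \hat v}{\partial c_k}\ge\frac{\partial \hat v}{\partial c_l}\qquad\forall\, \hat f\in\widehat{\mathcal{F}},\ \hat v\in\widehat{\mathcal{V}},\ (c_k,c_l)\in\mathcal{Z}_{kl},$$ where $\mathcal{F}=\{P_{ij},Q_{ij},\ell_{ij}\}_{(i,j)\in\mathcal{E}}$, $\mathcal{V}=\{\nu_i\}_{i\in\mathcal{N}}$ are the NPF flow and voltage quantities and $\widehat{\mathcal{F}}=\{\hat P_{ij},\hat Q_{ij},\hat\ell_{ij}\}_{(i,j)\in\mathcal{E}}$, $\widehat{\mathcal{V}}=\{\hat\nu_i\}_{i\in\mathcal{N}}$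 the LPF ones, all regarded as functions of $(p_i,q_i)_{i\in\mathcal{N}}$.
   Context: The distribution network is a tree with node set $\mathcal{N}\cup\{0\}$, rooted at the substation node $0$, and edge set $\mathcal{E}$; $(i,j)\in\mathcal{E}$ means that $i$ is the parent of $j$. For distinct nodes, $i\prec j$ means that $i$ lies on the path connecting $j$ to the substation node $0$. Line $(i,j)$ has resistance $r_{ij}$ and reactance $x_{ij}$. Lines have positive but small impedances: $0<r_{ij}\ll 1$, $0<x_{ij}\ll 1$. Net active and reactive consumption at node $i$ are $p_i,q_i$. $P_{ij},Q_{ij}$ are the active and reactive power flows on line $(i,j)$, $\ell_{ij}$ is the squared current magnitude on it, and $\nu_i$ is the squared voltage magnitude at node $i$. $\nu^{nom}$ is the nominal squared voltage (1 pu) and $\Delta\nu_0$ is a given constant (drop in the substation voltage). NPF constraints: $\nu_0=\nu^{nom}-\Delta\nu_0$ and, for all $(i,j)\in\mathcal{E}$, $$P_{ij}=\sum_{m:(j,m)\in\mathcal{E}}P_{jm}+p_j+r_{ij}\ell_{ij},\qquad Q_{ij}=\sum_{m:(j,m)\in\mathcal{E}}Q_{jm}+q_j+x_{ij}\ell_{ij},$$ $$\nu_j=\nu_i-2r_{ij}P_{ij}-2x_{ij}Q_{ij}+(r_{ij}^2+x_{ij}^2)\ell_{ij},\qquad \ell_{ij}\nu_i=P_{ij}^2+Q_{ij}^2.$$ The NPF solution for fixed $(p,q)$ is the solution of the convex relaxation in which the last equality is replaced by $\ell_{ij}\nu_i\ge P_{ij}^2+Q_{ij}^2$ and the quantity $W^{VR}\max_{i\in\mathcal{N}}|\nu^{nom}-\nu_i|+\sum_{(i,j)\in\mathcal{E}}r_{ij}\ell_{ij}$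 is minimized (with $W^{VR}\ge 0$ a constant); under NRPF this solution is unique and satisfies the relaxed inequality with equality (known fact used as a standing convention). LPF constraints: $\hat\nu_0=\nu^{nom}-\Delta\nu_0$ and, for all $(i,j)\in\mathcal{E}$, $$\hat P_{ij}=\sum_{m:(j,m)\in\mathcal{E}}\hat P_{jm}+p_j,\quad \hat Q_{ij}=\sum_{m:(j,m)\in\mathcal{E}}\hat Q_{jm}+q_j,\quad \hat\nu_j=\hat\nu_i-2(r_{ij}\hat P_{ij}+x_{ij}\hat Q_{ij}),\quad \hat\ell_{ij}\hat\nu_i=\hat P_{ij}^2+\hat Q_{ij}^2.$$ NRPF condition: letting $\mathcal{N}_i\subseteq\mathcal{N}$ be the set of nodes of the subtree rooted at $i$ (including $i$), $\sum_{j\in\mathcal{N}_i}p_j\ge 0$ and $\sum_{j\in\mathcal{N}_i}q_j\ge 0$ for all $i\in\mathcal{N}$.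
   Formalization: Proved when the substation has exactly one child (else voltages on other feeders have zero derivative) and, for NPF, when no leaf has p=q=0 (else flows on its line have zero derivative); the voltage drop is taken nonnegative and less than nominal; impedances are below a load-dependent bound. *)

theory Defs
  imports "HOL-Analysis.Analysis"
begin

text \<open>
  \<^term>\<open>N\<close> is the set of non-substation nodes, \<^term>\<open>s\<close> the substation, and
  \<^term>\<open>(i, j) \<in> E\<close> means that \<^term>\<open>i\<close> is the parent of \<^term>\<open>j\<close>.
\<close>

definition radial_network :: "'a set \<Rightarrow> 'a \<Rightarrow> ('a \<times> 'a) set \<Rightarrow> bool" where
  "radial_network N s E \<longleftrightarrow>
     finite N \<and> s \<notin> N \<and> E \<subseteq> insert s N \<times> N \<and>
     (\<forall>j\<in>N. \<exists>!i. (i, j) \<in> E) \<and> (\<forall>j\<in>N. (s, j) \<in> E\<^sup>+)"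

text \<open>\<^term>\<open>i\<close> lies on the path from \<^term>\<open>s\<close> to \<^term>\<open>j\<close>, and differs from \<^term>\<open>j\<close>.\<close>

definition upstream :: "'a \<Rightarrow> ('a \<times> 'a) set \<Rightarrow> 'a \<Rightarrow> 'a \<Rightarrow> bool" where
  "upstream s E i j \<longleftrightarrow> i \<noteq> j \<and> (s, i) \<in> E\<^sup>* \<and> (i, j) \<in> E\<^sup>*"

definition subtree :: "'a set \<Rightarrow> ('a \<times> 'a) set \<Rightarrow> 'a \<Rightarrow> 'a set" where
  "subtree N E i = {j \<in> N. (i, j) \<in> E\<^sup>*}"

definition children :: "('a \<times> 'a) set \<Rightarrow> 'a \<Rightarrow> 'a set" where
  "children E j = {m. (j, m) \<in> E}"

text \<open>
  The net consumption of the whole network is one real vector \<open>c\<close> indexed by coordinates: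
  \<open>c (Active i)\<close> is $p_i$ and \<open>c (Reactive i)\<close> is $q_i$.
\<close>

datatype 'a coord = Active 'a | Reactive 'a

type_synonym 'a load = "'a coord \<Rightarrow> real"

definition nrpf :: "'a set \<Rightarrow> ('a \<times> 'a) set \<Rightarrow> 'a load \<Rightarrow> bool" where
  "nrpf N E c \<longleftrightarrow>
     (\<forall>i\<in>N. 0 \<le> (\<Sum>j\<in>subtree N E i. c (Active j)) \<and>
            0 \<le> (\<Sum>j\<in>subtree N E i. c (Reactive j)))"

definition leaves_loaded :: "'a set \<Rightarrow> ('a \<times> 'a) set \<Rightarrow> 'a load \<Rightarrow> bool" where
  "leaves_loaded N E c \<longleftrightarrow>
     (\<forall>j\<in>N. children E j = {} \<longrightarrow> c (Active j) \<noteq> 0 \<or> c (Reactive j) \<noteq> 0)"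

text \<open>
  The two arguments of the line quantities are the end points of the line; only the values at
  lines and at nodes of the network are meaningful.
\<close>

record 'a flow_state =
  Pflow :: "'a \<Rightarrow> 'a \<Rightarrow> real"
  Qflow :: "'a \<Rightarrow> 'a \<Rightarrow> real"
  sqcur :: "'a \<Rightarrow> 'a \<Rightarrow> real"
  sqvolt :: "'a \<Rightarrow> real"

text \<open>
  The convex relaxation. Squared magnitudes are nonnegative; without these bounds the relaxed
  constraint would not be a (convex) rotated cone constraint.
\<close>

definition npf_relaxed ::
  "'a set \<Rightarrow> 'a \<Rightarrow> ('a \<times> 'a) set \<Rightarrow> ('a \<Rightarrow> 'a \<Rightarrow> real) \<Rightarrow> ('a \<Rightarrow> 'a \<Rightarrow> real) \<Rightarrow>
   real \<Rightarrow> real \<Rightarrow> 'a load \<Rightarrow> 'a flow_state \<Rightarrow> bool" where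
  "npf_relaxed N s E r x vnom dv0 c S \<longleftrightarrow>
     sqvolt S s = vnom - dv0 \<and>
     (\<forall>i\<in>insert s N. 0 \<le> sqvolt S i) \<and>
     (\<forall>(i, j)\<in>E.
        0 \<le> sqcur S i j \<and>
        Pflow S i j = (\<Sum>m\<in>children E j. Pflow S j m) + c (Active j) + r i j * sqcur S i j \<and>
        Qflow S i j = (\<Sum>m\<in>children E j. Qflow S j m) + c (Reactive j) + x i j * sqcur S i j \<and>
        sqvolt S j = sqvolt S i - 2 * r i j * Pflow S i j - 2 * x i j * Qflow S i j
                       + ((r i j)\<^sup>2 + (x i j)\<^sup>2) * sqcur S i j \<and>
        sqcur S i j * sqvolt S i \<ge> (Pflow S i j)\<^sup>2 + (Qflow S i j)\<^sup>2)"

definition npf_objective ::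
  "'a set \<Rightarrow> ('a \<times> 'a) set \<Rightarrow> ('a \<Rightarrow> 'a \<Rightarrow> real) \<Rightarrow> real \<Rightarrow> real \<Rightarrow> 'a flow_state \<Rightarrow> real" where
  "npf_objective N E r vnom W S =
     W * Max ((\<lambda>i. \<bar>vnom - sqvolt S i\<bar>) ` N) + (\<Sum>(i, j)\<in>E. r i j * sqcur S i j)"

definition is_npf_solution ::
  "'a set \<Rightarrow> 'a \<Rightarrow> ('a \<times> 'a) set \<Rightarrow> ('a \<Rightarrow> 'a \<Rightarrow> real) \<Rightarrow> ('a \<Rightarrow> 'a \<Rightarrow> real) \<Rightarrow>
   real \<Rightarrow> real \<Rightarrow> real \<Rightarrow> 'a load \<Rightarrow> 'a flow_state \<Rightarrow> bool" where
  "is_npf_solution N s E r x vnom dv0 W c S \<longleftrightarrow>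
     npf_relaxed N s E r x vnom dv0 c S \<and>
     (\<forall>S'. npf_relaxed N s E r x vnom dv0 c S' \<longrightarrow>
           npf_objective N E r vnom W S \<le> npf_objective N E r vnom W S')"

text \<open>
  A solution can only be unique up to the meaningless values off the network, hence
  \<open>SOME\<close> rather than \<open>THE\<close>.
\<close>

definition npf ::
  "'a set \<Rightarrow> 'a \<Rightarrow> ('a \<times> 'a) set \<Rightarrow> ('a \<Rightarrow> 'a \<Rightarrow> real) \<Rightarrow> ('a \<Rightarrow> 'a \<Rightarrow> real) \<Rightarrow>
   real \<Rightarrow> real \<Rightarrow> real \<Rightarrow> 'a load \<Rightarrow> 'a flow_state" where
  "npf N s E r x vnom dv0 W c = (SOME S. is_npf_solution N s E r x vnom dv0 W c S)"

definition is_lpf_solution ::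
  "'a \<Rightarrow> ('a \<times> 'a) set \<Rightarrow> ('a \<Rightarrow> 'a \<Rightarrow> real) \<Rightarrow> ('a \<Rightarrow> 'a \<Rightarrow> real) \<Rightarrow>
   real \<Rightarrow> real \<Rightarrow> 'a load \<Rightarrow> 'a flow_state \<Rightarrow> bool" where
  "is_lpf_solution s E r x vnom dv0 c S \<longleftrightarrow>
     sqvolt S s = vnom - dv0 \<and>
     (\<forall>(i, j)\<in>E.
        Pflow S i j = (\<Sum>m\<in>children E j. Pflow S j m) + c (Active j) \<and>
        Qflow S i j = (\<Sum>m\<in>children E j. Qflow S j m) + c (Reactive j) \<and>
        sqvolt S j = sqvolt S i - 2 * (r i j * Pflow S i j + x i j * Qflow S i j) \<and>
        sqcur S i j * sqvolt S i = (Pflow S i j)\<^sup>2 + (Qflow S i j)\<^sup>2)"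

definition lpf ::
  "'a \<Rightarrow> ('a \<times> 'a) set \<Rightarrow> ('a \<Rightarrow> 'a \<Rightarrow> real) \<Rightarrow> ('a \<Rightarrow> 'a \<Rightarrow> real) \<Rightarrow>
   real \<Rightarrow> real \<Rightarrow> 'a load \<Rightarrow> 'a flow_state" where
  "lpf s E r x vnom dv0 c = (SOME S. is_lpf_solution s E r x vnom dv0 c S)"

text \<open>The flow and voltage quantities of a power flow model, as functions of the consumption.\<close>

definition flow_quantities ::
  "('a \<times> 'a) set \<Rightarrow> ('a load \<Rightarrow> 'a flow_state) \<Rightarrow> ('a load \<Rightarrow> real) set" where
  "flow_quantities E M =
     (\<Union>(i, j)\<in>E. {\<lambda>c. Pflow (M c) i j, \<lambda>c. Qflow (M c) i j, \<lambda>c. sqcur (M c) i j})"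

definition voltage_quantities ::
  "'a set \<Rightarrow> ('a load \<Rightarrow> 'a flow_state) \<Rightarrow> ('a load \<Rightarrow> real) set" where
  "voltage_quantities N M = (\<lambda>i c. sqvolt (M c) i) ` N"

definition partially_differentiable :: "('a load \<Rightarrow> real) \<Rightarrow> 'a coord \<Rightarrow> 'a load \<Rightarrow> bool" where
  "partially_differentiable f z c \<longleftrightarrow> (\<lambda>t. f (c(z := t))) field_differentiable at (c z)"

definition partial :: "('a load \<Rightarrow> real) \<Rightarrow> 'a coord \<Rightarrow> 'a load \<Rightarrow> real" where
  "partial f z c = deriv (\<lambda>t. f (c(z := t))) (c z)"

definition coord_pairs :: "'a \<Rightarrow> 'a \<Rightarrow> ('a coord \<times> 'a coord) set" where
  "coord_pairs k l = {(Active k, Active l), (Reactive k, Reactive l)}"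

end

theory Submission
  imports Defs
begin

text \<open>
  The relaxed constraints say that the squared currents dominate a map that is increasing in the
  currents (losses increase the flows and lower the voltages) as long as all flows are nonnegative.
  By Knaster--Tarski there is then a least feasible current vector; it satisfies the current equation
  with equality and minimizes both parts of the objective, so it is the NPF solution. Loads near
  \<open>c\<close> may violate NRPF, but when the leaves are loaded the losses on the leaf lines
  keep the flows of every feasible point nonnegative.

  The difference quotients of the solution satisfy exactly a linear system that is a contraction
  for small impedances, so they converge to the solution of the limiting system. That system has
  nonnegative coefficients. Its source term for consumption at \<open>k\<close>, and for the
  difference between \<open>l\<close> and \<open>k\<close>, is nonnegative and nonzero,
  hence so is the solution. It is strictly positive because any additional loss is
  carried by the feeder line, which lowers all other voltages and so raises all other currents.
\<close>

section \<open>Least fixed points\<close>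

text \<open>The strict inequalities dictate the hypotheses. With two lines leaving the substation, a
  load behind one would leave everything behind the other unchanged; and at a leaf without load the
  current on its line vanishes to first order. The obstacle is that a derivative needs the optimizer
  for loads on both sides of the given one, so its structure has to be known slightly outside NRPF.

  No implicit function theorem enters: the current equation is quadratic, so its values at two loads
  subtract to an exact factorization, and the quotient by the load change solves a linear system.
  The same order-theoretic fixed point argument produces the optimizer and the nonnegative solution
  of that system, so no sign analysis of an inverse matrix is required.

  The impedance bound must be fixed before the impedances. The a priori bounds are therefore built
  from the lossless flows and the substation voltage alone, and the losses are then forced to be
  dominated by them.\<close>

lemma least_fixed_point_real:
  fixes F :: "('a \<Rightarrow> real) \<Rightarrow> 'a \<Rightarrow> real"
  assumes mono: "\<And>g h j. (\<And>i. i \<in> N \<Longrightarrow> L i \<le> g i \<and> g i \<le> h i \<and> h i \<le> U i) \<Longrightarrow> j \<in> N \<Longrightarrow> F g j \<le> F h j"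
    and LU: "\<And>j. j \<in> N \<Longrightarrow> L j \<le> U j"
    and L: "\<And>j. j \<in> N \<Longrightarrow> L j \<le> F L j"
    and U: "\<And>j. j \<in> N \<Longrightarrow> F U j \<le> U j"
  obtains y where "\<And>j. j \<in> N \<Longrightarrow> L j \<le> y j \<and> y j \<le> U j \<and> F y j = y j"
    and "\<And>h j. (\<And>i. i \<in> N \<Longrightarrow> L i \<le> h i \<and> h i \<le> U i \<and> F h i \<le> h i) \<Longrightarrow> j \<in> N \<Longrightarrow> y j \<le> h j"
proof -
  \<comment> \<open>Pre-fixed points within the box. Restricting to the box replaces completeness of
    the lattice: \<open>U\<close> makes the family nonempty, \<open>L\<close> bounds it from below,
    and the coordinatewise infimum is only ever used on \<open>N\<close>.\<close>
  define X where "X = {h. \<forall>i\<in>N. L i \<le> h i \<and> h i \<le> U i \<and> F h i \<le> h i}"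
  define y where "y j = (INF h\<in>X. h j)" for j
  have UX: "U \<in> X"
    using LU U by (auto simp: X_def)
  have lower: "y j \<le> h j" if "h \<in> X" "j \<in> N" for h j
    unfolding y_def by (rule cINF_lower[OF _ that(1)]) (use that in \<open>auto simp: X_def intro!: bdd_belowI2\<close>)
  have greatest: "m \<le> y j" if "\<And>h. h \<in> X \<Longrightarrow> m \<le> h j" for m j
    unfolding y_def by (rule cINF_greatest) (use UX that in auto)
  have Ly: "L j \<le> y j" if "j \<in> N" for j
    by (rule greatest) (use that in \<open>auto simp: X_def\<close>)
  have yU: "y j \<le> U j" if "j \<in> N" for j
    using lower[OF UX that] .
  have Fy: "F y j \<le> y j" if j: "j \<in> N" for j
  proof (rule greatest)
    fix h assume h: "h \<in> X"
    have "F y j \<le> F h j"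
      by (rule mono) (use h j Ly lower in \<open>auto simp: X_def\<close>)
    then show "F y j \<le> h j"
      using h j by (force simp: X_def)
  qed
  have LFy: "L j \<le> F y j" if "j \<in> N" for j
    using mono[of L y j] L[of j] Ly yU that by force
  \<comment> \<open>By monotonicity the image of a pre-fixed point is again one, so minimality of
    \<open>y\<close> gives the missing inequality \<open>y \<le> F y\<close>.\<close>
  have "F y \<in> X"
    unfolding X_def using LFy Fy yU mono[of "F y" y] by (auto intro: order_trans)
  then have "F y j = y j" if "j \<in> N" for j
    using lower[of "F y" j] Fy that by force
  then show thesis
    using that[of y] Ly yU lower by (auto simp: X_def)
qed

section \<open>Rooted trees\<close>

locale radial =
  fixes N :: "'a set" and s :: 'a and E :: "('a \<times> 'a) set"
  assumes network: "radial_network N s E"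
begin

definition parent :: "'a \<Rightarrow> 'a" where
  "parent j = (THE i. (i, j) \<in> E)"

text \<open>\<open>below\<close> and \<open>above\<close> are the two summation operators that solve
  the network equations: power balance is accumulated from the leaves upwards, voltage drops from
  the root downwards.\<close>

definition below :: "('a \<Rightarrow> real) \<Rightarrow> 'a \<Rightarrow> real" where
  "below g j = (\<Sum>n\<in>subtree N E j. g n)"

definition above :: "('a \<Rightarrow> real) \<Rightarrow> 'a \<Rightarrow> real" where
  "above g i = (\<Sum>n\<in>{n \<in> N. (n, i) \<in> E\<^sup>*}. g n)"

lemma finite_nodes: "finite N"
  using network by (simp add: radial_network_def)

lemma root_notin: "s \<notin> N"
  using network by (simp add: radial_network_def)

lemma edgeD: "(i, j) \<in> E \<Longrightarrow> i \<in> insert s N" "(i, j) \<in> E \<Longrightarrow> j \<in> N"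
  using network by (auto simp: radial_network_def)

lemma finite_edges: "finite E"
  by (rule finite_subset[of _ "insert s N \<times> N"]) (use edgeD finite_nodes in auto)

lemma ex1_parent: "j \<in> N \<Longrightarrow> \<exists>!i. (i, j) \<in> E"
  using network by (simp add: radial_network_def)

lemma parent_eq: "(i, j) \<in> E \<Longrightarrow> parent j = i"
  unfolding parent_def by (rule the1_equality[OF ex1_parent[OF edgeD(2)]])

lemma parent_edge: "j \<in> N \<Longrightarrow> (parent j, j) \<in> E"
  unfolding parent_def by (rule theI'[OF ex1_parent])

lemma parent_in: "j \<in> N \<Longrightarrow> parent j \<in> insert s N"
  using parent_edge edgeD(1) by blast

lemma reachable: "j \<in> N \<Longrightarrow> (s, j) \<in> E\<^sup>+"
  using network by (simp add: radial_network_def)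

lemma no_path_to_root: "(i, s) \<in> E\<^sup>* \<Longrightarrow> i = s"
  using edgeD(2) root_notin by (metis rtranclE)

lemma rtrancl_parent: "(i, j) \<in> E\<^sup>* \<Longrightarrow> i \<noteq> j \<Longrightarrow> (i, parent j) \<in> E\<^sup>*"
  using parent_eq by (metis rtranclE)

text \<open>Acyclicity follows from unique parents and reachability: a cycle through a node passes
  through its parent as well, so it would climb up to the root, which has no parent.\<close>

lemma acyclic_edges: "acyclic E"
proof -
  have "(j, j) \<notin> E\<^sup>+" if "(s, j) \<in> E\<^sup>+" for j
    using that
  proof induction
    case (base j)
    show ?case
    proof
      assume "(j, j) \<in> E\<^sup>+"
      then obtain i where "(j, i) \<in> E\<^sup>*" "(i, j) \<in> E"
        by (meson tranclD2)
      then show False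
        using base parent_eq no_path_to_root edgeD(2) root_notin by metis
    qed
  next
    case (step i j)
    show ?case
    proof
      assume "(j, j) \<in> E\<^sup>+"
      then obtain i' where "(j, i') \<in> E\<^sup>*" "(i', j) \<in> E"
        by (meson tranclD2)
      then have "(j, i) \<in> E\<^sup>*"
        using step parent_eq by metis
      then show False
        using step by (meson rtrancl_into_trancl2)
    qed
  qed
  then show ?thesis
    unfolding acyclic_def using reachable edgeD(2) by (metis tranclD2)
qed

lemma path_antisym: "(i, j) \<in> E\<^sup>* \<Longrightarrow> (j, i) \<in> E\<^sup>* \<Longrightarrow> i = j"
  using acyclic_edges acyclic_impl_antisym_rtrancl antisymD by metis

lemma wf_converse_edges: "wf (E\<inverse>)"
  using finite_edges acyclic_edges by (rule finite_acyclic_wf_converse)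

lemma subtree_subset: "subtree N E j \<subseteq> N"
  by (auto simp: subtree_def)

lemma finite_subtree: "finite (subtree N E j)"
  using finite_nodes subtree_subset finite_subset by blast

lemma self_in_subtree: "j \<in> N \<Longrightarrow> j \<in> subtree N E j"
  by (simp add: subtree_def)

lemma children_subset: "children E j \<subseteq> N"
  using edgeD(2) by (auto simp: children_def)

lemma finite_children: "finite (children E j)"
  using finite_nodes children_subset finite_subset by blast

lemma subtree_rec:
  assumes "j \<in> N"
  shows "subtree N E j = insert j (\<Union>m\<in>children E j. subtree N E m)"
proof -
  have "(j, n) \<in> E\<^sup>* \<longleftrightarrow> n = j \<or> (\<exists>m. (j, m) \<in> E \<and> (m, n) \<in> E\<^sup>*)" for n
    by (blast elim: converse_rtranclE intro: converse_rtrancl_into_rtrancl)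
  then show ?thesis
    unfolding subtree_def children_def using assms by blast
qed

text \<open>Since parents are unique, the ancestors of a node form a chain.\<close>

lemma paths_comparable:
  assumes "(i, n) \<in> E\<^sup>*" "(j, n) \<in> E\<^sup>*"
  shows "(i, j) \<in> E\<^sup>* \<or> (j, i) \<in> E\<^sup>*"
  using assms
proof (induction)
  case (step m n)
  then show ?case
    by (metis parent_eq rtrancl.rtrancl_into_rtrancl rtrancl_parent)
qed simp

lemma subtrees_disjoint:
  assumes "m \<in> children E j" "m' \<in> children E j" "m \<noteq> m'"
  shows "subtree N E m \<inter> subtree N E m' = {}"
proof -
  have False if "(m, m') \<in> E\<^sup>*" "(j, m) \<in> E" "(j, m') \<in> E" "m \<noteq> m'" for m m'
    using that rtrancl_parent[OF that(1)] parent_eq acyclic_edges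
    by (metis acyclic_def rtrancl_into_trancl2)
  then show ?thesis
    using assms paths_comparable by (fastforce simp: subtree_def children_def)
qed

lemma below_rec:
  assumes "j \<in> N"
  shows "below g j = g j + (\<Sum>m\<in>children E j. below g m)"
proof -
  have "j \<notin> (\<Union>m\<in>children E j. subtree N E m)"
    using acyclic_edges by (auto simp: subtree_def children_def acyclic_def dest: rtrancl_into_trancl2)
  moreover have "(\<Sum>n\<in>(\<Union>m\<in>children E j. subtree N E m). g n) = (\<Sum>m\<in>children E j. below g m)"
    unfolding below_def
    by (rule sum.UNION_disjoint) (use finite_children finite_subtree subtrees_disjoint in auto)
  ultimately show ?thesis
    unfolding below_def subtree_rec[OF assms]
    using finite_children finite_subtree by (subst sum.insert) auto
qed

text \<open>Gives the closed form of the flows in an arbitrary solution of the balance equations, by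
  induction from the leaves.\<close>

lemma below_unique:
  assumes "\<And>j. j \<in> N \<Longrightarrow> h j = g j + (\<Sum>m\<in>children E j. h m)" and "j \<in> N"
  shows "h j = below g j"
  using wf_converse_edges assms(2)
proof (induction j rule: wf_induct_rule)
  case (less j)
  have "h m = below g m" if "m \<in> children E j" for m
    using less that edgeD(2) by (auto simp: children_def)
  then show ?case
    using assms(1)[of j] below_rec[of j g] less.prems by simp
qed

lemma leaf_in_subtree:
  assumes "j \<in> N"
  shows "\<exists>f\<in>subtree N E j. children E f = {}"
  using wf_converse_edges assms
proof (induction j rule: wf_induct_rule)
  case (less j)
  show ?case
  proof (cases "children E j = {}")
    case True
    then show ?thesis
      using less.prems self_in_subtree by blast
  next
    case False
    then obtain m where m: "(j, m) \<in> E"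
      by (auto simp: children_def)
    then obtain f where "f \<in> subtree N E m" "children E f = {}"
      using less.IH[of m] edgeD(2) by auto
    then show ?thesis
      using m by (auto simp: subtree_def intro: converse_rtrancl_into_rtrancl)
  qed
qed

lemma above_root: "above g s = 0"
proof -
  have "{n \<in> N. (n, s) \<in> E\<^sup>*} = {}"
    using no_path_to_root root_notin by blast
  then show ?thesis
    unfolding above_def by (simp only: sum.empty)
qed

lemma above_step:
  assumes "(i, j) \<in> E"
  shows "above g j = above g i + g j"
proof -
  have "{n \<in> N. (n, j) \<in> E\<^sup>*} = insert j {n \<in> N. (n, i) \<in> E\<^sup>*}"
    using assms edgeD(2) rtrancl_parent parent_eq by (auto intro: rtrancl_into_rtrancl) metis
  moreover have "(j, i) \<notin> E\<^sup>*"
    using assms acyclic_edges by (meson acyclic_def rtrancl_into_trancl1)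
  ultimately show ?thesis
    unfolding above_def using finite_nodes by simp
qed

text \<open>The counterpart for voltages: the value at the root and the drops along the lines
  determine all of them.\<close>

lemma above_unique:
  assumes "\<And>i j. (i, j) \<in> E \<Longrightarrow> v j = v i - g j" and "i \<in> insert s N"
  shows "v i = v s - above g i"
proof (cases "i = s")
  case False
  then have "(s, i) \<in> E\<^sup>+"
    using assms(2) reachable by blast
  then show ?thesis
  proof induction
    case (base j)
    then show ?case
      using assms(1) above_step[of s j g] above_root[of g] by force
  next
    case (step i j)
    then show ?case
      using assms(1) above_step[of i j g] by force
  qed
qed (simp add: above_root)

lemma below_nonneg: "(\<And>n. n \<in> N \<Longrightarrow> 0 \<le> g n) \<Longrightarrow> 0 \<le> below g j"
  unfolding below_def using subtree_subset by (intro sum_nonneg) auto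

lemma below_mono: "(\<And>n. n \<in> N \<Longrightarrow> g n \<le> h n) \<Longrightarrow> below g j \<le> below h j"
  unfolding below_def using subtree_subset by (intro sum_mono) auto

lemma below_ge_member:
  assumes "\<And>n. n \<in> N \<Longrightarrow> 0 \<le> g n" "n \<in> subtree N E j"
  shows "g n \<le> below g j"
  unfolding below_def using assms subtree_subset finite_subtree by (intro member_le_sum) auto

lemma above_nonneg: "(\<And>n. n \<in> N \<Longrightarrow> 0 \<le> g n) \<Longrightarrow> 0 \<le> above g j"
  unfolding above_def by (intro sum_nonneg) auto

lemma above_mono: "(\<And>n. n \<in> N \<Longrightarrow> g n \<le> h n) \<Longrightarrow> above g j \<le> above h j"
  unfolding above_def by (intro sum_mono) auto

lemma above_ge_member:
  assumes "\<And>n. n \<in> N \<Longrightarrow> 0 \<le> g n" "n \<in> N" "(n, j) \<in> E\<^sup>*"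
  shows "g n \<le> above g j"
  unfolding above_def using assms finite_nodes by (intro member_le_sum) auto

lemma abs_sum_nodes_le:
  assumes "\<And>n. n \<in> N \<Longrightarrow> \<bar>g n\<bar> \<le> m" "0 \<le> m" "A \<subseteq> N"
  shows "\<bar>sum g A\<bar> \<le> real (card N) * m"
proof -
  have "\<bar>sum g A\<bar> \<le> (\<Sum>n\<in>A. m)"
    using assms by (intro order.trans[OF sum_abs] sum_mono) auto
  also have "\<dots> \<le> real (card N) * m"
    using assms card_mono[OF finite_nodes assms(3)] by (simp add: mult_right_mono)
  finally show ?thesis .
qed

lemma abs_above_le:
  assumes "\<And>n. n \<in> N \<Longrightarrow> \<bar>g n\<bar> \<le> m" "0 \<le> m"
  shows "\<bar>above g j\<bar> \<le> real (card N) * m"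
  unfolding above_def using assms by (intro abs_sum_nodes_le) auto

lemma sum_edges: "(\<Sum>(i, j)\<in>E. g i j) = (\<Sum>j\<in>N. g (parent j) j)"
  by (rule sum.reindex_bij_witness[of _ "\<lambda>j. (parent j, j)" snd])
    (use parent_eq parent_edge edgeD(2) in auto)

lemma below_leaf:
  assumes "f \<in> N" "children E f = {}"
  shows "below g f = g f"
  using below_rec[OF assms(1), of g] assms(2) by simp

text \<open>The single line out of the substation carries every load and every loss, and its voltage
  drop reaches every node. All strict inequalities that hold across branches come from this
  line.\<close>

lemma feeder_subtree:
  assumes "\<exists>!j. (s, j) \<in> E"
  obtains f where "f \<in> N" "subtree N E f = N"
    "\<And>j. j \<in> N \<Longrightarrow> j \<noteq> f \<Longrightarrow> parent j \<in> N"
proof -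
  obtain f where f: "(s, f) \<in> E" "\<And>j. (s, j) \<in> E \<Longrightarrow> j = f"
    using assms by blast
  have "(f, j) \<in> E\<^sup>*" if "j \<in> N" for j
    using reachable[OF that] f(2) by (metis tranclD)
  moreover have "parent j \<in> N" if "j \<in> N" "j \<noteq> f" for j
    using that parent_in parent_edge f(2) by (metis insertE)
  ultimately show thesis
    using that[of f] f(1) edgeD(2) by (auto simp: subtree_def)
qed

end

section \<open>Flows and voltages as functions of the currents\<close>

text \<open>
  A line is indexed by its lower end point. The type \<^typ>\<open>bool\<close> distinguishes active (\<^term>\<open>True\<close>)
  from reactive power: \<open>z True\<close> is the resistance and \<open>z False\<close> the reactance, which makes the power
  flow equations symmetric in the two kinds of power.
\<close>

locale lines = radial N s E
  for N :: "'a set" and s :: 'a and E :: "('a \<times> 'a) set" +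
  fixes z :: "bool \<Rightarrow> 'a \<Rightarrow> real" and v0 :: real
  assumes z_pos: "j \<in> N \<Longrightarrow> 0 < z b j"
begin

definition flow :: "(bool \<Rightarrow> 'a \<Rightarrow> real) \<Rightarrow> ('a \<Rightarrow> real) \<Rightarrow> bool \<Rightarrow> 'a \<Rightarrow> real" where
  "flow a l b j = below (\<lambda>n. a b n + z b n * l n) j"

text \<open>
  The factor in parentheses is the sum of the sending-end flow \<open>flow a l b j\<close> and the receiving-end flow
  \<open>flow a l b j - z b j * l j\<close>; both increase with the currents, although the term
  \<open>- z b j * l j\<close> alone decreases.
\<close>

definition drop :: "(bool \<Rightarrow> 'a \<Rightarrow> real) \<Rightarrow> ('a \<Rightarrow> real) \<Rightarrow> 'a \<Rightarrow> real" where
  "drop a l j = (\<Sum>b\<in>UNIV. z b j * (2 * flow a l b j - z b j * l j))"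

definition volt :: "(bool \<Rightarrow> 'a \<Rightarrow> real) \<Rightarrow> ('a \<Rightarrow> real) \<Rightarrow> 'a \<Rightarrow> real" where
  "volt a l i = v0 - above (drop a l) i"

lemma flow_split: "flow a l b j = below (a b) j + below (\<lambda>n. z b n * l n) j"
  by (simp add: flow_def below_def sum.distrib)

text \<open>The line's own loss cancels at the receiving end, which leaves only the losses strictly
  below it. This is why the receiving-end flow is still monotone in the currents.\<close>

lemma received_split:
  assumes "j \<in> N"
  shows "flow a l b j - z b j * l j = below (a b) j + (\<Sum>n\<in>subtree N E j - {j}. z b n * l n)"
  using assms finite_subtree self_in_subtree
  by (simp add: flow_split below_def sum.remove[of "subtree N E j" j])

text \<open>Linearity is joint in loads and currents. It applies to a difference quotient by viewing
  the perturbed pair as the old pair plus \<open>t\<close> times the pair of direction and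
  quotient.\<close>

lemma flow_linear:
  "flow (\<lambda>b n. x * a b n + y * a' b n) (\<lambda>n. x * l n + y * l' n) b j = x * flow a l b j + y * flow a' l' b j"
  by (simp add: flow_def below_def algebra_simps sum.distrib sum_distrib_left)

lemma drop_linear:
  "drop (\<lambda>b n. x * a b n + y * a' b n) (\<lambda>n. x * l n + y * l' n) j = x * drop a l j + y * drop a' l' j"
  unfolding drop_def flow_linear by (simp add: algebra_simps UNIV_bool)

lemma above_drop_linear:
  "above (drop (\<lambda>b n. x * a b n + y * a' b n) (\<lambda>n. x * l n + y * l' n)) i
     = x * above (drop a l) i + y * above (drop a' l') i"
  by (simp add: above_def drop_linear sum.distrib sum_distrib_left)

lemma flow_mono:
  assumes "\<And>n. n \<in> N \<Longrightarrow> l n \<le> l' n"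
  shows "flow a l b j \<le> flow a l' b j"
  unfolding flow_def by (rule below_mono) (use assms z_pos in \<open>simp add: mult_left_mono less_imp_le\<close>)

lemma received_mono:
  assumes "\<And>n. n \<in> N \<Longrightarrow> l n \<le> l' n" "j \<in> N"
  shows "flow a l b j - z b j * l j \<le> flow a l' b j - z b j * l' j"
  unfolding received_split[OF assms(2)]
  by (intro add_left_mono sum_mono) (use assms z_pos[THEN less_imp_le] subtree_subset[of j] in \<open>auto intro!: mult_left_mono\<close>)

lemma drop_mono:
  assumes "\<And>n. n \<in> N \<Longrightarrow> l n \<le> l' n" "j \<in> N"
  shows "drop a l j \<le> drop a l' j"
proof -
  have "2 * flow a l b j - z b j * l j \<le> 2 * flow a l' b j - z b j * l' j" for b
    using flow_mono[of l l' a b j, OF assms(1)] received_mono[of l l' j a b, OF assms] by simp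
  then show ?thesis
    unfolding drop_def using z_pos[OF assms(2), THEN less_imp_le] by (intro sum_mono mult_left_mono) auto
qed

lemma volt_antimono:
  assumes "\<And>n. n \<in> N \<Longrightarrow> l n \<le> l' n"
  shows "volt a l' i \<le> volt a l i"
  unfolding volt_def using above_mono[of "drop a l" "drop a l'" i] drop_mono[OF assms] by simp

lemma flow_cong: "(\<And>n. n \<in> N \<Longrightarrow> l n = l' n) \<Longrightarrow> flow a l b j = flow a l' b j"
  by (intro antisym flow_mono) simp_all

lemma volt_cong: "(\<And>n. n \<in> N \<Longrightarrow> l n = l' n) \<Longrightarrow> volt a l i = volt a l' i"
  by (intro antisym volt_antimono) simp_all

lemma flow_has_derivative:
  assumes "\<And>n. n \<in> N \<Longrightarrow> ((\<lambda>t. l t n) has_real_derivative y n) (at t0)"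
  shows "((\<lambda>t. flow (\<lambda>b n. a b n + t * e b n) (l t) b j) has_real_derivative flow e y b j) (at t0)"
proof -
  have "((\<lambda>t. \<Sum>n\<in>subtree N E j. a b n + t * e b n + z b n * l t n) has_real_derivative
      (\<Sum>n\<in>subtree N E j. e b n + z b n * y n)) (at t0)"
  proof (rule DERIV_sum)
    fix n assume "n \<in> subtree N E j"
    then have "n \<in> N"
      using subtree_subset by blast
    from assms[OF this] show "((\<lambda>t. a b n + t * e b n + z b n * l t n) has_real_derivative e b n + z b n * y n) (at t0)"
      by (auto intro!: derivative_eq_intros)
  qed
  then show ?thesis
    by (simp add: flow_def below_def)
qed

lemma drop_has_derivative:
  assumes "\<And>n. n \<in> N \<Longrightarrow> ((\<lambda>t. l t n) has_real_derivative y n) (at t0)" "j \<in> N"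
  shows "((\<lambda>t. drop (\<lambda>b n. a b n + t * e b n) (l t) j) has_real_derivative drop e y j) (at t0)"
  unfolding drop_def
  by (rule DERIV_sum)
    (auto intro!: derivative_eq_intros flow_has_derivative[where y = y] assms)

lemma volt_has_derivative:
  assumes "\<And>n. n \<in> N \<Longrightarrow> ((\<lambda>t. l t n) has_real_derivative y n) (at t0)"
  shows "((\<lambda>t. volt (\<lambda>b n. a b n + t * e b n) (l t) i) has_real_derivative - above (drop e y) i) (at t0)"
proof -
  have "((\<lambda>t. above (drop (\<lambda>b n. a b n + t * e b n) (l t)) i) has_real_derivative above (drop e y) i) (at t0)"
    unfolding above_def
    by (rule DERIV_sum) (auto intro!: drop_has_derivative assms)
  then show ?thesis
    unfolding volt_def by (auto intro!: derivative_eq_intros)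
qed

lemma flow_tendsto:
  assumes "\<And>n. n \<in> N \<Longrightarrow> ((\<lambda>t. l t n) \<longlongrightarrow> l0 n) (at 0)"
  shows "((\<lambda>t. flow (\<lambda>b n. a b n + t * e b n) (l t) b j) \<longlongrightarrow> flow a l0 b j) (at 0)"
proof -
  have "((\<lambda>t. \<Sum>n\<in>subtree N E j. a b n + t * e b n + z b n * l t n) \<longlongrightarrow>
      (\<Sum>n\<in>subtree N E j. a b n + 0 * e b n + z b n * l0 n)) (at 0)"
    by (intro tendsto_intros assms) (use subtree_subset in auto)
  then show ?thesis
    by (simp add: flow_def below_def)
qed

lemma volt_tendsto:
  assumes "\<And>n. n \<in> N \<Longrightarrow> ((\<lambda>t. l t n) \<longlongrightarrow> l0 n) (at 0)"
  shows "((\<lambda>t. volt (\<lambda>b n. a b n + t * e b n) (l t) i) \<longlongrightarrow> volt a l0 i) (at 0)"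
  unfolding volt_def above_def drop_def
  by (intro tendsto_intros assms flow_tendsto[where ?l0.0 = l0]) auto

text \<open>The relaxed constraints after elimination of flows and voltages, with the currents as
  the only unknowns.\<close>

definition feasible :: "(bool \<Rightarrow> 'a \<Rightarrow> real) \<Rightarrow> ('a \<Rightarrow> real) \<Rightarrow> bool" where
  "feasible a l \<longleftrightarrow>
     (\<forall>j\<in>N. 0 \<le> l j \<and> (\<Sum>b\<in>UNIV. (flow a l b j)\<^sup>2) \<le> l j * volt a l (parent j)) \<and>
     (\<forall>i\<in>insert s N. 0 \<le> volt a l i)"

end

section \<open>The least solution of the current equation\<close>

locale small_lines = lines N s E z v0
  for N :: "'a set" and s :: 'a and E :: "('a \<times> 'a) set" and z :: "bool \<Rightarrow> 'a \<Rightarrow> real" and v0 :: real +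
  \<comment> \<open>\<^term>\<open>A\<close> bounds the lossless flows, \<^term>\<open>K\<close> the currents and \<^term>\<open>\<epsilon>\<close> the impedances.\<close>
  fixes A K \<epsilon> :: real
  assumes A_pos: "0 < A" and K_pos: "0 < K" and eps_pos: "0 < \<epsilon>" and v0_pos: "0 < v0"
    and z_le: "j \<in> N \<Longrightarrow> z b j \<le> \<epsilon>"
    and small_loss: "real (card N) * (\<epsilon> * K) \<le> A"
    and small_drop: "real (card N) * (8 * A * \<epsilon>) \<le> v0 / 2"
    and large_current: "8 * A\<^sup>2 \<le> K * v0 / 2"
    and small_feedback: "8 * A * (real (card N) * \<epsilon>) + K * (4 * (real (card N) * \<epsilon>)\<^sup>2) \<le> v0 / 4"
begin

text \<open>The bounds are those available at the largest current \<open>K\<close> when the lossless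
  flows are at most \<open>A\<close>: losses add at most another \<open>A\<close>, and at most
  \<open>card N\<close> drops of size \<open>8 * A * \<epsilon>\<close> cost no more than half of
  \<open>v0\<close>.\<close>

definition regular :: "(bool \<Rightarrow> 'a \<Rightarrow> real) \<Rightarrow> ('a \<Rightarrow> real) \<Rightarrow> bool" where
  "regular a l \<longleftrightarrow>
     (\<forall>j\<in>N. 0 \<le> l j \<and> l j \<le> K \<and> l j * volt a l (parent j) = (\<Sum>b\<in>UNIV. (flow a l b j)\<^sup>2) \<and>
        (\<forall>b. 0 \<le> flow a l b j \<and> flow a l b j \<le> 2 * A)) \<and>
     (\<forall>i\<in>insert s N. v0 / 2 \<le> volt a l i \<and> volt a l i \<le> v0)"

text \<open>
  \<open>L\<close> bounds from below the currents of every feasible point, and the flows that it induces are already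
  nonnegative. Hence the current map is monotone above \<open>L\<close> even if \<open>a\<close> violates NRPF slightly.
\<close>

definition floored :: "(bool \<Rightarrow> 'a \<Rightarrow> real) \<Rightarrow> ('a \<Rightarrow> real) \<Rightarrow> bool" where
  "floored a L \<longleftrightarrow>
     (\<forall>j\<in>N. 0 \<le> L j \<and> (\<forall>b. \<bar>below (a b) j\<bar> \<le> A \<and> z b j * L j \<le> 2 * flow a L b j)) \<and>
     (\<forall>l. (\<forall>j\<in>N. 0 \<le> l j) \<longrightarrow>
        (\<forall>j\<in>N. 2 * v0 * L j \<le> (\<Sum>b\<in>UNIV. (flow a l b j)\<^sup>2)) \<and> (\<forall>i\<in>insert s N. volt a l i \<le> 2 * v0))"

lemma abs_scaled_le:
  assumes "j \<in> N" "\<bar>h j\<bar> \<le> m"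
  shows "\<bar>z b j * h j\<bar> \<le> \<epsilon> * m"
  using assms z_pos[of j b] z_le[of j b] by (simp add: abs_mult mult_mono)

lemma abs_losses_le:
  assumes "\<And>n. n \<in> N \<Longrightarrow> \<bar>h n\<bar> \<le> m" "0 \<le> m" "B \<subseteq> N"
  shows "\<bar>\<Sum>n\<in>B. z b n * h n\<bar> \<le> real (card N) * (\<epsilon> * m)"
  using assms eps_pos by (intro abs_sum_nodes_le abs_scaled_le) auto

text \<open>The factor 4 counts two kinds of power, each with a sending-end and a receiving-end flow
  under the same bound.\<close>

lemma abs_drop_le:
  assumes j: "j \<in> N" and h: "\<And>n. n \<in> N \<Longrightarrow> \<bar>h n\<bar> \<le> m" "0 \<le> m"
    and a: "\<And>b. \<bar>below (a b) j\<bar> \<le> A0"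
  shows "\<bar>drop a h j\<bar> \<le> 4 * \<epsilon> * (A0 + real (card N) * (\<epsilon> * m))"
proof -
  define D where "D = A0 + real (card N) * (\<epsilon> * m)"
  have "\<bar>z b j * (2 * flow a h b j - z b j * h j)\<bar> \<le> \<epsilon> * (2 * D)" for b
  proof -
    have "\<bar>flow a h b j\<bar> \<le> D"
      using abs_losses_le[of h m "subtree N E j" b, OF h subtree_subset] a[of b]
      unfolding flow_split D_def below_def[of "\<lambda>n. z b n * h n"] by linarith
    moreover have "\<bar>flow a h b j - z b j * h j\<bar> \<le> D"
      using abs_losses_le[of h m "subtree N E j - {j}" b, OF h] subtree_subset[of j] a[of b]
      unfolding received_split[OF j] D_def by fastforce
    ultimately have "\<bar>2 * flow a h b j - z b j * h j\<bar> \<le> 2 * D"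
      by linarith
    then show ?thesis
      using z_pos[OF j, of b] z_le[OF j, of b] unfolding abs_mult by (intro mult_mono) auto
  qed
  from this[of True] this[of False] show ?thesis
    unfolding drop_def D_def[symmetric] by (simp add: UNIV_bool)
qed

text \<open>The map \<open>F\<close> sends currents to squared flow over voltage, the currents that
  they would induce. Between \<open>L\<close> and the constant \<open>K\<close> it is monotone,
  because the flows are nonnegative from \<open>L\<close> on and the voltages stay positive up to
  \<open>K\<close>; the two barriers are mapped inwards. Feasible points are pre-fixed points of
  \<open>F\<close>, up to a truncation at \<open>K\<close>.\<close>

lemma least_regular:
  assumes "floored a L"
  obtains l where "regular a l" "\<And>l' j. feasible a l' \<Longrightarrow> j \<in> N \<Longrightarrow> l j \<le> l' j"
proof -
  have L0: "0 \<le> L j" and load: "\<bar>below (a b) j\<bar> \<le> A" and sending: "z b j * L j \<le> 2 * flow a L b j"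
    if "j \<in> N" for b j
    using assms that by (auto simp: floored_def)
  have current: "2 * v0 * L j \<le> (\<Sum>b\<in>UNIV. (flow a l b j)\<^sup>2)" if "j \<in> N" "\<And>i. i \<in> N \<Longrightarrow> 0 \<le> l i" for l j
    using assms that by (auto simp: floored_def)
  have volt_upper: "volt a l i \<le> 2 * v0" if "i \<in> insert s N" "\<And>i. i \<in> N \<Longrightarrow> 0 \<le> l i" for l i
    using assms that unfolding floored_def by blast
  define U where "U = (\<lambda>_ :: 'a. K)"
  define F where "F l j = (\<Sum>b\<in>UNIV. (flow a l b j)\<^sup>2) / volt a l (parent j)" for l j
  have U: "\<bar>U n\<bar> \<le> K" for n
    using K_pos by (simp add: U_def)
  have loss_U: "\<bar>below (\<lambda>n. z b n * U n) j\<bar> \<le> A" for b j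
    unfolding below_def
    using abs_losses_le[of U K "subtree N E j" b, OF U _ subtree_subset] small_loss K_pos by simp
  have flow_U: "flow a U b j \<le> 2 * A" if "j \<in> N" for b j
    using load[OF that, of b] loss_U[of b j] by (simp add: flow_split)
  have "\<bar>drop a U j\<bar> \<le> 8 * A * \<epsilon>" if "j \<in> N" for j
  proof -
    have "\<bar>drop a U j\<bar> \<le> 4 * \<epsilon> * (A + real (card N) * (\<epsilon> * K))"
      using abs_drop_le[OF that U] K_pos load[OF that] by simp
    also have "\<dots> \<le> 4 * \<epsilon> * (A + A)"
      using small_loss eps_pos by simp
    finally show ?thesis
      by (simp add: ac_simps)
  qed
  then have "above (drop a U) i \<le> v0 / 2" for i
    using abs_above_le[of "drop a U" "8 * A * \<epsilon>" i] small_drop A_pos eps_pos by simp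
  then have volt_U: "v0 / 2 \<le> volt a U i" for i
    by (simp add: volt_def field_simps)
  have flow_L: "0 \<le> flow a L b j" if "j \<in> N" for b j
    using sending[OF that, of b] mult_nonneg_nonneg[OF less_imp_le[OF z_pos[OF that]] L0[OF that], of b] by simp
  have flow_sq: "(\<Sum>b\<in>UNIV. (flow a g b j)\<^sup>2) \<le> (\<Sum>b\<in>UNIV. (flow a h b j)\<^sup>2)"
    if "j \<in> N" "\<And>i. i \<in> N \<Longrightarrow> L i \<le> g i" "\<And>i. i \<in> N \<Longrightarrow> g i \<le> h i" for g h j
  proof (intro sum_mono power_mono)
    show "flow a g b j \<le> flow a h b j" "0 \<le> flow a g b j" for b
      using flow_mono[of g h a b j] flow_mono[of L g a b j] flow_L[OF that(1), of b] that by auto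
  qed
  have volt_pos: "0 < volt a l i" if "\<And>i. i \<in> N \<Longrightarrow> l i \<le> U i" for l i
    using volt_antimono[of l U a i, OF that] volt_U[of i] v0_pos by linarith
  have sq_nonneg: "0 \<le> (\<Sum>b\<in>UNIV. (flow a l b j)\<^sup>2)" for l j
    by (intro sum_nonneg) auto
  have sq_U: "(\<Sum>b\<in>UNIV. (flow a U b j)\<^sup>2) \<le> 8 * A\<^sup>2" if j: "j \<in> N" for j
  proof -
    have "(\<Sum>b\<in>UNIV. (flow a U b j)\<^sup>2) \<le> (\<Sum>b\<in>(UNIV :: bool set). (2 * A)\<^sup>2)"
    proof (rule sum_mono)
      fix b
      have "\<bar>flow a U b j\<bar> \<le> 2 * A"
        using loss_U[of b j] load[OF j, of b] by (simp add: flow_split)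
      then show "(flow a U b j)\<^sup>2 \<le> (2 * A)\<^sup>2"
        using A_pos by (intro power2_le_iff_abs_le[THEN iffD2]) auto
    qed
    then show ?thesis
      by (simp add: UNIV_bool power_mult_distrib)
  qed
  have LU: "L j \<le> U j" if j: "j \<in> N" for j
  proof -
    have "2 * v0 * L j \<le> 8 * A\<^sup>2"
      using K_pos by (intro order_trans[OF current sq_U] j) (simp add: U_def)
    then have "v0 * (4 * L j) \<le> v0 * K"
      using large_current by (simp add: ac_simps)
    then have "4 * L j \<le> K"
      using v0_pos by simp
    then show ?thesis
      using K_pos by (simp add: U_def)
  qed
  have LF: "L j \<le> F L j" if j: "j \<in> N" for j
  proof -
    have "L j * volt a L (parent j) \<le> L j * (2 * v0)"
      using volt_upper[OF parent_in[OF j]] L0[OF j] L0 by (intro mult_left_mono) auto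
    also have "\<dots> \<le> (\<Sum>b\<in>UNIV. (flow a L b j)\<^sup>2)"
      using current[OF j L0] by (simp add: mult.commute)
    finally show ?thesis
      unfolding F_def using volt_pos[OF LU] by (simp add: pos_le_divide_eq)
  qed
  have FU: "F U j \<le> U j" if j: "j \<in> N" for j
  proof -
    have "(\<Sum>b\<in>UNIV. (flow a U b j)\<^sup>2) \<le> K * (v0 / 2)"
      using sq_U[OF j] large_current by simp
    also have "\<dots> \<le> K * volt a U (parent j)"
      using volt_U K_pos by (intro mult_left_mono) auto
    finally show ?thesis
      unfolding F_def U_def[symmetric] using volt_pos[of U "parent j"] by (simp add: pos_divide_le_eq U_def)
  qed
  have mono: "F g j \<le> F h j" if "\<And>i. i \<in> N \<Longrightarrow> L i \<le> g i \<and> g i \<le> h i \<and> h i \<le> U i" "j \<in> N" for g h j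
    unfolding F_def using that volt_pos[of h] sq_nonneg
    by (intro frac_le flow_sq volt_antimono) auto
  obtain l where l: "\<And>j. j \<in> N \<Longrightarrow> L j \<le> l j \<and> l j \<le> U j \<and> F l j = l j"
    and least: "\<And>h j. (\<And>i. i \<in> N \<Longrightarrow> L i \<le> h i \<and> h i \<le> U i \<and> F h i \<le> h i) \<Longrightarrow> j \<in> N \<Longrightarrow> l j \<le> h j"
    using least_fixed_point_real[of N L U F, OF mono LU LF FU] by blast
  show thesis
  proof (rule that)
    \<comment> \<open>Without NRPF a single receiving-end flow could be negative. The sum of both
      ends is nonnegative at \<open>L\<close> by \<open>sending\<close> and increases with the
      currents.\<close>
    have "0 \<le> drop a l j" if j: "j \<in> N" for j
    proof -
      have "0 \<le> 2 * flow a l b j - z b j * l j" for b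
        using flow_mono[of L l a b j] received_mono[of L l j a b] l j sending[OF j, of b] by simp
      then show ?thesis
        unfolding drop_def using z_pos[OF j, THEN less_imp_le] by (intro sum_nonneg mult_nonneg_nonneg) auto
    qed
    then have "volt a l i \<le> v0" for i
      by (simp add: volt_def above_nonneg)
    moreover have "v0 / 2 \<le> volt a l i" for i
      using volt_antimono[of l U a i] l volt_U[of i] by (simp add: order_trans)
    moreover have "0 \<le> flow a l b j" "flow a l b j \<le> 2 * A" if "j \<in> N" for b j
      using flow_mono[of L l a b j] flow_mono[of l U a b j] l flow_L[OF that, of b] flow_U[OF that, of b] by force+
    moreover have "0 \<le> l j" "l j \<le> K" "l j * volt a l (parent j) = (\<Sum>b\<in>UNIV. (flow a l b j)\<^sup>2)" if "j \<in> N" for j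
      using l[OF that] L0[OF that] volt_pos[of l "parent j"] l by (auto simp: U_def F_def field_simps)
    ultimately show "regular a l"
      by (simp add: regular_def)
  next
    fix l' j
    assume l': "feasible a l'" and j: "j \<in> N"
    \<comment> \<open>A feasible current may exceed \<open>K\<close> and leave the box. Truncation
      lowers the flows and raises the voltages, so \<open>F m\<close> stays below \<open>l'\<close>,
      and it stays below \<open>U\<close> because \<open>F U\<close> does.\<close>
    define m where "m i = min (l' i) (U i)" for i
    have Ll': "L i \<le> l' i" if i: "i \<in> N" for i
    proof -
      have "v0 * 2 * L i \<le> l' i * volt a l' (parent i)"
        using current[OF i, of l'] l' i by (force simp: feasible_def)
      also have "\<dots> \<le> l' i * (2 * v0)"
        using volt_upper[OF parent_in[OF i], of l'] l' i by (intro mult_left_mono) (auto simp: feasible_def)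
      finally show ?thesis
        using v0_pos by simp
    qed
    have "F m i \<le> m i" if i: "i \<in> N" for i
    proof -
      have "F m i \<le> F U i"
        using i Ll' LU by (intro mono) (auto simp: m_def)
      moreover have "F m i \<le> l' i"
      proof -
        have "(\<Sum>b\<in>UNIV. (flow a m b i)\<^sup>2) \<le> (\<Sum>b\<in>UNIV. (flow a l' b i)\<^sup>2)"
          using i Ll' LU by (intro flow_sq) (auto simp: m_def)
        also have "\<dots> \<le> l' i * volt a l' (parent i)"
          using l' i by (simp add: feasible_def)
        also have "\<dots> \<le> l' i * volt a m (parent i)"
          using l' i by (intro mult_left_mono volt_antimono) (auto simp: feasible_def m_def)
        finally show ?thesis
          unfolding F_def using volt_pos[of m "parent i"] by (simp add: m_def pos_divide_le_eq)
      qed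
      ultimately show ?thesis
        using FU[OF i] by (simp add: m_def)
    qed
    moreover have "L i \<le> m i \<and> m i \<le> U i" if "i \<in> N" for i
      using Ll' LU that by (simp add: m_def)
    ultimately have "l j \<le> m j"
      using j by (intro least) auto
    then show "l j \<le> l' j"
      by (simp add: m_def)
  qed
qed

section \<open>The linearized current equation\<close>

text \<open>One set of bounds for two systems: that of a difference quotient, where
  \<open>\<beta>\<close> is a sum of two flows of at most \<open>2 * A\<close>, and the limiting
  one, where \<open>\<beta>\<close> is twice a flow.\<close>

definition moderate :: "('a \<Rightarrow> real) \<Rightarrow> (bool \<Rightarrow> 'a \<Rightarrow> real) \<Rightarrow> ('a \<Rightarrow> real) \<Rightarrow> bool" where
  "moderate \<alpha> \<beta> \<gamma> \<longleftrightarrow>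
     (\<forall>j\<in>N. v0 / 2 \<le> \<alpha> j \<and> 0 \<le> \<gamma> j \<and> \<gamma> j \<le> K \<and> (\<forall>b. 0 \<le> \<beta> b j \<and> \<beta> b j \<le> 4 * A))"

lemma moderateD:
  assumes "moderate \<alpha> \<beta> \<gamma>" "j \<in> N"
  shows "v0 / 2 \<le> \<alpha> j" "0 < \<alpha> j" "0 \<le> \<gamma> j" "\<gamma> j \<le> K" "0 \<le> \<beta> b j" "\<beta> b j \<le> 4 * A"
  using assms v0_pos by (force simp: moderate_def)+

text \<open>
  The linearized current equation reads \<open>\<alpha> j * h j = response e \<beta> \<gamma> h j\<close>, where \<open>h\<close> is the change of
  the currents under a change of the loads in direction \<open>e\<close>. For a difference quotient the coefficients
  are the new voltage, the sum of the old and new flows and the old current.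
\<close>

definition response ::
  "(bool \<Rightarrow> 'a \<Rightarrow> real) \<Rightarrow> (bool \<Rightarrow> 'a \<Rightarrow> real) \<Rightarrow> ('a \<Rightarrow> real) \<Rightarrow> ('a \<Rightarrow> real) \<Rightarrow> 'a \<Rightarrow> real" where
  "response e \<beta> \<gamma> h j = (\<Sum>b\<in>UNIV. \<beta> b j * flow e h b j) + \<gamma> j * above (drop e h) (parent j)"

definition linearized ::
  "(bool \<Rightarrow> 'a \<Rightarrow> real) \<Rightarrow> ('a \<Rightarrow> real) \<Rightarrow> (bool \<Rightarrow> 'a \<Rightarrow> real) \<Rightarrow> ('a \<Rightarrow> real) \<Rightarrow> ('a \<Rightarrow> real) \<Rightarrow> bool" where
  "linearized e \<alpha> \<beta> \<gamma> h \<longleftrightarrow> (\<forall>j\<in>N. \<alpha> j * h j = response e \<beta> \<gamma> h j)"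

lemma response_linear:
  "response (\<lambda>b n. x * e b n + y * e' b n) \<beta> \<gamma> (\<lambda>n. x * h n + y * h' n) j
     = x * response e \<beta> \<gamma> h j + y * response e' \<beta> \<gamma> h' j"
  unfolding response_def flow_linear above_drop_linear by (simp add: algebra_simps UNIV_bool)

text \<open>Separates the direct effect of the load change from the feedback through the currents.
  Only the feedback has to be small.\<close>

lemma response_split:
  "response e \<beta> \<gamma> h j = response e \<beta> \<gamma> (\<lambda>_. 0) j + response (\<lambda>_ _. 0) \<beta> \<gamma> h j"
  using response_linear[of 1 e 1 "\<lambda>_ _. 0" \<beta> \<gamma> "\<lambda>_. 0" h j] by simp

text \<open>\<open>small_feedback\<close> is exactly this estimate, its first term for the flows and
  its second for the voltages. The constant \<open>v0 / 4\<close> is half of the lower bound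
  \<open>v0 / 2\<close> on \<open>\<alpha>\<close>, so the feedback divided by
  \<open>\<alpha>\<close> contracts with factor 1/2.\<close>

lemma abs_feedback_le:
  assumes mod: "moderate \<alpha> \<beta> \<gamma>" and h: "\<And>n. n \<in> N \<Longrightarrow> \<bar>h n\<bar> \<le> m" "0 \<le> m" and j: "j \<in> N"
  shows "\<bar>response (\<lambda>_ _. 0) \<beta> \<gamma> h j\<bar> \<le> v0 / 4 * m"
proof -
  define D where "D = real (card N) * (\<epsilon> * m)"
  have "\<bar>flow (\<lambda>_ _. 0) h b j\<bar> \<le> D" for b
    using abs_losses_le[of h m "subtree N E j" b, OF h subtree_subset] by (simp add: flow_def below_def D_def)
  then have "\<bar>\<beta> b j * flow (\<lambda>_ _. 0) h b j\<bar> \<le> 4 * A * D" for b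
    using moderateD(5,6)[OF mod j, of b] unfolding abs_mult by (intro mult_mono) auto
  then have "\<bar>\<Sum>b\<in>UNIV. \<beta> b j * flow (\<lambda>_ _. 0) h b j\<bar> \<le> (\<Sum>b\<in>(UNIV :: bool set). 4 * A * D)"
    by (intro order_trans[OF sum_abs] sum_mono)
  then have "\<bar>\<Sum>b\<in>UNIV. \<beta> b j * flow (\<lambda>_ _. 0) h b j\<bar> \<le> 8 * A * D"
    by (simp add: UNIV_bool)
  moreover have "\<bar>drop (\<lambda>_ _. 0) h n\<bar> \<le> 4 * \<epsilon> * D" if "n \<in> N" for n
    using abs_drop_le[of n h m "\<lambda>_ _. 0" 0, OF that h] by (simp add: below_def D_def)
  then have "\<bar>above (drop (\<lambda>_ _. 0) h) i\<bar> \<le> real (card N) * (4 * \<epsilon> * D)" for i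
    using eps_pos h(2) by (intro abs_above_le) (auto simp: D_def)
  then have "\<bar>\<gamma> j * above (drop (\<lambda>_ _. 0) h) (parent j)\<bar> \<le> K * (real (card N) * (4 * \<epsilon> * D))"
    using moderateD[OF mod j] K_pos unfolding abs_mult by (intro mult_mono) auto
  ultimately have "\<bar>response (\<lambda>_ _. 0) \<beta> \<gamma> h j\<bar> \<le> 8 * A * D + K * (real (card N) * (4 * \<epsilon> * D))"
    unfolding response_def by linarith
  also have "\<dots> = (8 * A * (real (card N) * \<epsilon>) + K * (4 * (real (card N) * \<epsilon>)\<^sup>2)) * m"
    by (simp add: D_def power2_eq_square algebra_simps)
  also have "\<dots> \<le> v0 / 4 * m"
    using small_feedback h(2) by (rule mult_right_mono)
  finally show ?thesis .
qed

text \<open>At a node where \<open>\<bar>d\<bar>\<close> attains its maximum \<open>M\<close>, the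
  equation yields \<open>v0 / 2 * M \<le> v0 / 4 * M + R\<close>. This single estimate provides
  uniqueness (\<open>R = 0\<close>), boundedness of the difference quotients and their
  convergence.\<close>

lemma contraction_bound:
  assumes mod: "moderate \<alpha> \<beta> \<gamma>"
    and eq: "\<And>j. j \<in> N \<Longrightarrow> \<alpha> j * d j = response (\<lambda>_ _. 0) \<beta> \<gamma> d j + \<rho> j"
    and \<rho>: "\<And>j. j \<in> N \<Longrightarrow> \<bar>\<rho> j\<bar> \<le> R"
    and j: "j \<in> N"
  shows "\<bar>d j\<bar> \<le> 4 * R / v0"
proof -
  define M where "M = Max ((\<lambda>n. \<bar>d n\<bar>) ` N)"
  have le: "\<bar>d n\<bar> \<le> M" if "n \<in> N" for n
    unfolding M_def using finite_nodes that by (intro Max_ge) auto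
  have "M \<in> (\<lambda>n. \<bar>d n\<bar>) ` N"
    unfolding M_def using finite_nodes j by (intro Max_in) auto
  then obtain k where k: "k \<in> N" "M = \<bar>d k\<bar>"
    by blast
  have "v0 / 2 * M \<le> \<bar>\<alpha> k * d k\<bar>"
    using moderateD[OF mod k(1)] k(2) v0_pos unfolding abs_mult by (intro mult_mono) auto
  also have "\<dots> \<le> v0 / 4 * M + R"
    unfolding eq[OF k(1)] using k(2) le
    by (intro order_trans[OF abs_triangle_ineq] add_mono abs_feedback_le[OF mod _ _ k(1)] \<rho>[OF k(1)]) auto
  finally have "M \<le> 4 * R / v0"
    using v0_pos by (simp add: field_simps)
  then show ?thesis
    using le[OF j] by simp
qed

lemma linearized_unique:
  assumes "moderate \<alpha> \<beta> \<gamma>" "linearized e \<alpha> \<beta> \<gamma> h" "linearized e \<alpha> \<beta> \<gamma> h'" "j \<in> N"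
  shows "h j = h' j"
proof -
  have "\<bar>h j - h' j\<bar> \<le> 4 * 0 / v0"
  proof (rule contraction_bound[OF assms(1), where \<rho> = "\<lambda>_. 0"])
    fix i assume "i \<in> N"
    then show "\<alpha> i * (h i - h' i) = response (\<lambda>_ _. 0) \<beta> \<gamma> (\<lambda>j. h j - h' j) i + 0"
      using assms(2,3) response_linear[of 1 e "-1" e \<beta> \<gamma> h h' i]
      by (simp add: linearized_def algebra_simps)
  qed (use assms(4) in auto)
  then show ?thesis
    by simp
qed

text \<open>The voltage drop weighs the sum of sending-end and receiving-end flow. The latter is
  nonnegative here, so discarding it leaves a lower bound in terms of the former.\<close>

lemma drop_nonneg:
  assumes "j \<in> N" "\<And>n. n \<in> N \<Longrightarrow> 0 \<le> h n" "\<And>b. 0 \<le> below (e b) j"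
  shows "(\<Sum>b\<in>UNIV. z b j * flow e h b j) \<le> drop e h j" "0 \<le> flow e h b j" "0 \<le> drop e h j"
proof -
  have zh: "0 \<le> z b n * h n" if "n \<in> N" for b n
    using assms(2) z_pos that by (simp add: less_imp_le)
  have flow: "0 \<le> flow e h b j" for b
    unfolding flow_split using assms(3)[of b] below_nonneg[of "\<lambda>n. z b n * h n" j] zh by simp
  then show "0 \<le> flow e h b j" .
  have "z b j * flow e h b j \<le> z b j * (2 * flow e h b j - z b j * h j)" for b
  proof (rule mult_left_mono)
    have "0 \<le> flow e h b j - z b j * h j"
      unfolding received_split[OF assms(1)] using assms(3) zh subtree_subset[of j]
      by (intro add_nonneg_nonneg sum_nonneg) auto
    then show "flow e h b j \<le> 2 * flow e h b j - z b j * h j"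
      by simp
  qed (use z_pos[OF assms(1)] in \<open>auto simp: less_imp_le\<close>)
  then show le: "(\<Sum>b\<in>UNIV. z b j * flow e h b j) \<le> drop e h j"
    unfolding drop_def by (intro sum_mono) auto
  have "0 \<le> (\<Sum>b\<in>UNIV. z b j * flow e h b j)"
    using flow z_pos[OF assms(1)] by (intro sum_nonneg mult_nonneg_nonneg) (auto simp: less_imp_le)
  then show "0 \<le> drop e h j"
    using le by simp
qed

text \<open>All coefficients are nonnegative, so the least fixed point theorem applies above 0. The
  upper barrier \<open>4 * R / v0\<close> works because source and feedback contribute at most
  \<open>R\<close> each, and \<open>2 * R\<close> is the barrier times
  \<open>v0 / 2\<close>.\<close>

lemma linearized_solution:
  assumes mod: "moderate \<alpha> \<beta> \<gamma>" and e: "\<And>b j. j \<in> N \<Longrightarrow> 0 \<le> below (e b) j"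
  obtains y where "linearized e \<alpha> \<beta> \<gamma> y" "\<And>j. j \<in> N \<Longrightarrow> 0 \<le> y j"
proof -
  define R where "R = (\<Sum>j\<in>N. \<bar>response e \<beta> \<gamma> (\<lambda>_. 0) j\<bar>)"
  have R: "\<bar>response e \<beta> \<gamma> (\<lambda>_. 0) j\<bar> \<le> R" if "j \<in> N" for j
    unfolding R_def using finite_nodes that by (intro member_le_sum) auto
  have R0: "0 \<le> R"
    unfolding R_def by (intro sum_nonneg) auto
  define F where "F h j = response e \<beta> \<gamma> h j / \<alpha> j" for h j
  define U where "U = (\<lambda>_ :: 'a. 4 * R / v0)"
  have mono: "F g j \<le> F h j" if le: "\<And>i. i \<in> N \<Longrightarrow> 0 \<le> g i \<and> g i \<le> h i \<and> h i \<le> U i" and j: "j \<in> N" for g h j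
  proof -
    have le': "\<And>n. n \<in> N \<Longrightarrow> g n \<le> h n"
      using le by blast
    have "flow e g b j \<le> flow e h b j" for b
      using flow_mono[of g h e b j, OF le'] .
    moreover have "above (drop e g) (parent j) \<le> above (drop e h) (parent j)"
      using drop_mono[of g h _ e, OF le'] by (intro above_mono)
    ultimately show ?thesis
      unfolding F_def response_def using moderateD[OF mod j]
      by (intro divide_right_mono add_mono sum_mono mult_left_mono) auto
  qed
  have F0: "0 \<le> F (\<lambda>_. 0) j" if j: "j \<in> N" for j
  proof -
    have "0 \<le> flow e (\<lambda>_. 0) b j" for b
      using drop_nonneg(2)[of j "\<lambda>_. 0" e b] e j by simp
    moreover have "0 \<le> above (drop e (\<lambda>_. 0)) (parent j)"
      using drop_nonneg(3)[of _ "\<lambda>_. 0" e] e by (simp add: above_nonneg)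
    ultimately show ?thesis
      unfolding F_def response_def using moderateD[OF mod j]
      by (intro divide_nonneg_nonneg add_nonneg_nonneg sum_nonneg mult_nonneg_nonneg) auto
  qed
  have FU: "F U j \<le> U j" if j: "j \<in> N" for j
  proof -
    have "\<bar>response (\<lambda>_ _. 0) \<beta> \<gamma> U j\<bar> \<le> v0 / 4 * (4 * R / v0)"
      using R0 v0_pos j by (intro abs_feedback_le[OF mod]) (auto simp: U_def)
    then have "response e \<beta> \<gamma> U j \<le> 2 * R"
      using R[OF j] v0_pos by (subst response_split) simp
    also have "\<dots> = U j * (v0 / 2)"
      using v0_pos by (simp add: U_def)
    also have "\<dots> \<le> U j * \<alpha> j"
      using moderateD[OF mod j] R0 v0_pos by (intro mult_left_mono) (auto simp: U_def)
    finally show ?thesis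
      unfolding F_def using moderateD[OF mod j] by (simp add: pos_divide_le_eq)
  qed
  have U0: "0 \<le> U j" for j
    using R0 v0_pos by (simp add: U_def)
  obtain y where y: "\<And>j. j \<in> N \<Longrightarrow> 0 \<le> y j \<and> y j \<le> U j \<and> F y j = y j"
    using least_fixed_point_real[of N "\<lambda>_. 0" U F, OF mono U0 F0 FU] by metis
  have "\<alpha> j * y j = response e \<beta> \<gamma> y j" if j: "j \<in> N" for j
    using y[OF j] moderateD(2)[OF mod j] by (simp add: F_def field_simps)
  then show thesis
    using y by (intro that[of y]) (auto simp: linearized_def)
qed

text \<open>Losses couple the two kinds of power: a positive flow of one kind at \<open>k\<close>
  raises the current there, and its loss raises the feeder flow of both kinds. The resulting drop
  lowers every voltage, hence raises every current, and each line's own loss then makes its flows of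
  both kinds positive.\<close>

lemma linearized_positive:
  assumes mod: "moderate \<alpha> \<beta> \<gamma>" and feeder: "\<exists>!j. (s, j) \<in> E"
    and strict: "\<And>b j. j \<in> N \<Longrightarrow> 0 < \<beta> b j" "\<And>j. j \<in> N \<Longrightarrow> 0 < \<gamma> j"
    and e: "\<And>b j. j \<in> N \<Longrightarrow> 0 \<le> below (e b) j"
    and e0: "k \<in> N" "0 < below (e b0) k"
    and lin: "linearized e \<alpha> \<beta> \<gamma> y" and j: "j \<in> N"
  shows "0 < y j" "0 < flow e y b j" "0 < above (drop e y) j"
proof -
  obtain y' where "linearized e \<alpha> \<beta> \<gamma> y'" "\<And>j. j \<in> N \<Longrightarrow> 0 \<le> y' j"
    using linearized_solution[where e = e, OF mod e] by blast
  then have y: "0 \<le> y n" if "n \<in> N" for n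
    using linearized_unique[OF mod lin] that by force
  obtain f where f: "f \<in> N" "subtree N E f = N" "\<And>j. j \<in> N \<Longrightarrow> j \<noteq> f \<Longrightarrow> parent j \<in> N"
    using feeder_subtree[OF feeder] by metis
  have zy: "0 \<le> z b n * y n" if "n \<in> N" for b n
    using y[OF that] z_pos[OF that, of b] by simp
  have drop0: "0 \<le> drop e y n" and flow0: "0 \<le> flow e y b n" if "n \<in> N" for n b
    using drop_nonneg[of n y e] that y e by auto
  have eqn: "\<alpha> n * y n = (\<Sum>b\<in>UNIV. \<beta> b n * flow e y b n) + \<gamma> n * above (drop e y) (parent n)" if "n \<in> N" for n
    using lin that by (simp add: linearized_def response_def)
  have y_pos: "0 < y n" if n: "n \<in> N" and flow: "0 < flow e y b n" for b n
  proof -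
    have "0 < \<beta> b n * flow e y b n"
      using strict(1)[OF n] flow by simp
    also have "\<dots> \<le> (\<Sum>b\<in>UNIV. \<beta> b n * flow e y b n)"
      using flow0[OF n] strict(1)[OF n] by (intro member_le_sum) (auto simp: less_imp_le)
    also have "\<dots> \<le> \<alpha> n * y n"
      unfolding eqn[OF n] using strict(2)[OF n] drop0 by (simp add: above_nonneg)
    finally show ?thesis
      using y[OF n] moderateD(2)[OF mod n] by (simp add: zero_less_mult_iff)
  qed
  have "0 < flow e y b0 k"
    unfolding flow_split using e0(2) below_nonneg[of "\<lambda>n. z b0 n * y n" k] zy by simp
  then have yk: "0 < y k"
    using y_pos e0(1) by blast
  have flow_f: "0 < flow e y b f" for b
  proof -
    have "0 < z b k * y k"
      using yk z_pos[OF e0(1)] by simp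
    also have "\<dots> \<le> below (\<lambda>n. z b n * y n) f"
      using below_ge_member[of "\<lambda>n. z b n * y n" k f] zy f(2) e0(1) by simp
    finally show ?thesis
      using e[OF f(1), of b] by (simp add: flow_split)
  qed
  have "0 < (\<Sum>b\<in>UNIV. z b f * flow e y b f)"
    using flow_f z_pos[OF f(1)] by (intro sum_pos) auto
  then have "0 < drop e y f"
    using drop_nonneg(1)[of f y e] f(1) y e by force
  moreover have "drop e y f \<le> above (drop e y) n" if "n \<in> N" for n
    using above_ge_member[of "drop e y" f n] drop0 f(1,2) that by (auto simp: subtree_def)
  ultimately have above_pos: "0 < above (drop e y) n" if "n \<in> N" for n
    using that by fastforce
  then show "0 < above (drop e y) j"
    using j by simp
  \<comment> \<open>The feeder line is the exception: its upper end is the substation, whose voltage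
    is fixed, so its current grows through its flow instead.\<close>
  have y_all: "0 < y n" if n: "n \<in> N" for n
  proof (cases "n = f")
    case True
    then show ?thesis
      using y_pos[OF f(1) flow_f] by simp
  next
    case False
    have "0 < \<gamma> n * above (drop e y) (parent n)"
      using above_pos[OF f(3)[OF n False]] strict(2)[OF n] by simp
    moreover have "0 \<le> (\<Sum>b\<in>UNIV. \<beta> b n * flow e y b n)"
      using flow0[OF n] strict(1)[OF n] by (intro sum_nonneg mult_nonneg_nonneg) (auto simp: less_imp_le)
    ultimately have "0 < \<alpha> n * y n"
      unfolding eqn[OF n] by simp
    then show ?thesis
      using y[OF n] moderateD(2)[OF mod n] by (simp add: zero_less_mult_iff)
  qed
  then show "0 < y j"
    using j by simp
  have "0 < z b j * y j"
    using y_all[OF j] z_pos[OF j] by simp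
  also have "\<dots> \<le> below (\<lambda>n. z b n * y n) j"
    using below_ge_member[of "\<lambda>n. z b n * y n" j j] zy j self_in_subtree by simp
  finally show "0 < flow e y b j"
    using e[OF j, of b] by (simp add: flow_split)
qed

text \<open>The coefficients of the system for the quotient depend on \<open>t\<close>, so the order
  matters: bounded quotients make \<open>l\<close> continuous at 0, continuity makes the
  coefficients converge, and only then does the contraction estimate bring the quotients to
  \<open>y\<close>.\<close>

lemma regular_differentiable:
  assumes \<tau>: "0 < \<tau>" and e: "\<And>b j. j \<in> N \<Longrightarrow> 0 \<le> below (e b) j"
    and reg: "\<And>t. \<bar>t\<bar> < \<tau> \<Longrightarrow> regular (\<lambda>b n. a b n + t * e b n) (l t)"
  obtains y where
    "linearized e (\<lambda>j. volt a (l 0) (parent j)) (\<lambda>b j. 2 * flow a (l 0) b j) (l 0) y"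
    "\<And>j. j \<in> N \<Longrightarrow> ((\<lambda>t. l t j) has_real_derivative y j) (at 0)"
proof -
  define h where "h t n = (l t n - l 0 n) / t" for t n
  define \<alpha> where "\<alpha> t j = volt (\<lambda>b n. a b n + t * e b n) (l t) (parent j)" for t j
  define \<beta> where "\<beta> t b j = flow (\<lambda>b n. a b n + t * e b n) (l t) b j + flow a (l 0) b j" for t b j
  have reg0: "regular a (l 0)"
    using reg[of 0] \<tau> by simp
  have mod: "moderate (\<alpha> t) (\<beta> t) (l 0)" if "\<bar>t\<bar> < \<tau>" for t
    unfolding moderate_def \<alpha>_def \<beta>_def
  proof (intro ballI conjI allI)
    fix j b assume j: "j \<in> N"
    show "v0 / 2 \<le> volt (\<lambda>b n. a b n + t * e b n) (l t) (parent j)" "0 \<le> l 0 j" "l 0 j \<le> K"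
      using reg[OF that] reg0 j parent_in[OF j] unfolding regular_def by blast+
    have "0 \<le> flow (\<lambda>b n. a b n + t * e b n) (l t) b j" "0 \<le> flow a (l 0) b j"
      "flow (\<lambda>b n. a b n + t * e b n) (l t) b j \<le> 2 * A" "flow a (l 0) b j \<le> 2 * A"
      using reg[OF that] reg0 j unfolding regular_def by blast+
    then show "0 \<le> flow (\<lambda>b n. a b n + t * e b n) (l t) b j + flow a (l 0) b j"
      "flow (\<lambda>b n. a b n + t * e b n) (l t) b j + flow a (l 0) b j \<le> 4 * A"
      by auto
  qed
  have quotient: "linearized e (\<alpha> t) (\<beta> t) (l 0) (h t)" if t: "\<bar>t\<bar> < \<tau>" "t \<noteq> 0" for t
    unfolding linearized_def response_def
  proof
    fix j assume j: "j \<in> N"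
    define V where "V = volt a (l 0) (parent j)"
    define D where "D = above (drop e (h t)) (parent j)"
    define f where "f b = flow a (l 0) b j" for b
    define g where "g b = flow e (h t) b j" for b
    have lt: "l t = (\<lambda>n. 1 * l 0 n + t * h t n)"
      using t by (auto simp: h_def)
    have flow_t: "flow (\<lambda>b n. a b n + t * e b n) (l t) b j = f b + t * g b" for b
      using flow_linear[of 1 a t e "l 0" "h t" b j] unfolding lt[symmetric] by (simp add: f_def g_def)
    have volt_t: "\<alpha> t j = V - t * D"
      using above_drop_linear[of 1 a t e "l 0" "h t" "parent j"] unfolding lt[symmetric]
      by (simp add: \<alpha>_def volt_def V_def D_def)
    have "l 0 j * V = (\<Sum>b\<in>UNIV. (f b)\<^sup>2)"
      using reg0 j by (simp add: regular_def V_def f_def)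
    moreover have "(l 0 j + t * h t j) * (V - t * D) = (\<Sum>b\<in>UNIV. (f b + t * g b)\<^sup>2)"
    proof -
      have "l t j * \<alpha> t j = (\<Sum>b\<in>UNIV. (f b + t * g b)\<^sup>2)"
        using reg[OF t(1)] j unfolding regular_def \<alpha>_def flow_t[symmetric] by blast
      then show ?thesis
        using fun_cong[OF lt, of j] by (simp add: volt_t)
    qed
    \<comment> \<open>Differences of squares factor into sum times difference, and the change of a
      product is new voltage times change of current plus old current times change of voltage. The
      equation is thus exactly linear in the quotient.\<close>
    ultimately have "t * ((V - t * D) * h t j) = t * ((\<Sum>b\<in>UNIV. (2 * f b + t * g b) * g b) + l 0 j * D)"
      by (simp add: UNIV_bool power2_eq_square algebra_simps)
    then have "(V - t * D) * h t j = (\<Sum>b\<in>UNIV. (2 * f b + t * g b) * g b) + l 0 j * D"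
      using t(2) by simp
    then show "\<alpha> t j * h t j = (\<Sum>b\<in>UNIV. \<beta> t b j * flow e (h t) b j) + l 0 j * above (drop e (h t)) (parent j)"
      unfolding volt_t \<beta>_def flow_t f_def[symmetric] g_def[symmetric] D_def[symmetric] by (simp add: algebra_simps)
  qed
  \<comment> \<open>Bounds the source term uniformly in \<open>t\<close>, by inserting the extreme
    coefficients \<open>4 * A\<close> and \<open>K\<close> and summing over the nodes.\<close>
  define R where "R = (\<Sum>j\<in>N. 4 * A * (\<Sum>b\<in>UNIV. \<bar>flow e (\<lambda>_. 0) b j\<bar>) + K * \<bar>above (drop e (\<lambda>_. 0)) (parent j)\<bar>)"
  have bounded: "\<bar>h t j\<bar> \<le> 4 * R / v0" if t: "\<bar>t\<bar> < \<tau>" "t \<noteq> 0" and j: "j \<in> N" for t j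
  proof (rule contraction_bound[OF mod[OF t(1)], where \<rho> = "response e (\<beta> t) (l 0) (\<lambda>_. 0)"])
    fix i assume i: "i \<in> N"
    show "\<alpha> t i * h t i = response (\<lambda>_ _. 0) (\<beta> t) (l 0) (h t) i + response e (\<beta> t) (l 0) (\<lambda>_. 0) i"
      using quotient[OF t] i response_split[of e "\<beta> t" "l 0" "h t" i] by (simp add: linearized_def)
    have "\<bar>response e (\<beta> t) (l 0) (\<lambda>_. 0) i\<bar> \<le>
        \<bar>\<Sum>b\<in>UNIV. \<beta> t b i * flow e (\<lambda>_. 0) b i\<bar> + \<bar>l 0 i * above (drop e (\<lambda>_. 0)) (parent i)\<bar>"
      unfolding response_def by (rule abs_triangle_ineq)
    also have "\<dots> \<le> (\<Sum>b\<in>UNIV. 4 * A * \<bar>flow e (\<lambda>_. 0) b i\<bar>) + K * \<bar>above (drop e (\<lambda>_. 0)) (parent i)\<bar>"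
    proof (intro add_mono order_trans[OF sum_abs] sum_mono)
      show "\<bar>\<beta> t b i * flow e (\<lambda>_. 0) b i\<bar> \<le> 4 * A * \<bar>flow e (\<lambda>_. 0) b i\<bar>" for b
        using moderateD(5,6)[OF mod[OF t(1)] i, of b] unfolding abs_mult by (intro mult_right_mono) auto
      show "\<bar>l 0 i * above (drop e (\<lambda>_. 0)) (parent i)\<bar> \<le> K * \<bar>above (drop e (\<lambda>_. 0)) (parent i)\<bar>"
        using moderateD(3,4)[OF mod[OF t(1)] i] unfolding abs_mult by (intro mult_right_mono) auto
    qed
    also have "\<dots> \<le> R"
      unfolding R_def sum_distrib_left[symmetric] using finite_nodes i A_pos K_pos
      by (intro member_le_sum[where f = "\<lambda>j. 4 * A * (\<Sum>b\<in>UNIV. \<bar>flow e (\<lambda>_. 0) b j\<bar>) + K * \<bar>above (drop e (\<lambda>_. 0)) (parent j)\<bar>"])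
        (auto intro!: add_nonneg_nonneg mult_nonneg_nonneg sum_nonneg)
    finally show "\<bar>response e (\<beta> t) (l 0) (\<lambda>_. 0) i\<bar> \<le> R" .
  qed (rule j)
  have near: "eventually (\<lambda>t. \<bar>t\<bar> < \<tau> \<and> t \<noteq> 0) (at 0)"
    unfolding eventually_at using \<tau> by (intro exI[of _ \<tau>]) (simp add: dist_real_def)
  have l_tendsto: "((\<lambda>t. l t n) \<longlongrightarrow> l 0 n) (at 0)" if n: "n \<in> N" for n
  proof (rule Lim_transform_bound[THEN Lim_null[THEN iffD2]])
    show "eventually (\<lambda>t. norm (l t n - l 0 n) \<le> norm (t * (4 * R / v0))) (at 0)"
      using near
    proof eventually_elim
      case (elim t)
      have "\<bar>l t n - l 0 n\<bar> = \<bar>t\<bar> * \<bar>h t n\<bar>"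
        using elim by (simp add: h_def)
      also have "\<dots> \<le> \<bar>t\<bar> * \<bar>4 * R / v0\<bar>"
        using elim n by (intro mult_left_mono order_trans[OF bounded abs_ge_self]) auto
      finally show ?case
        by (simp add: abs_mult)
    qed
    show "((\<lambda>t. t * (4 * R / v0)) \<longlongrightarrow> 0) (at 0)"
      using v0_pos by (auto intro!: tendsto_eq_intros)
  qed
  define \<alpha>0 where "\<alpha>0 j = volt a (l 0) (parent j)" for j
  define \<beta>0 where "\<beta>0 b j = 2 * flow a (l 0) b j" for b j
  have \<alpha>0: "\<alpha> 0 = \<alpha>0" and \<beta>0: "\<beta> 0 = \<beta>0"
    by (auto simp: fun_eq_iff \<alpha>_def \<alpha>0_def \<beta>_def \<beta>0_def)
  have mod0: "moderate \<alpha>0 \<beta>0 (l 0)"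
    using mod[of 0] \<tau> by (simp add: \<alpha>0 \<beta>0)
  obtain y where y: "linearized e \<alpha>0 \<beta>0 (l 0) y"
    using linearized_solution[where e = e, OF mod0 e] by blast
  \<comment> \<open>The residual of the limit \<^term>\<open>y\<close> in the system solved by the quotient \<^term>\<open>h t\<close>.\<close>
  define \<rho> where "\<rho> t j = \<alpha> t j * y j - response e (\<beta> t) (l 0) y j" for t j
  have \<rho>_tendsto: "((\<lambda>t. \<rho> t j) \<longlongrightarrow> 0) (at 0)" if j: "j \<in> N" for j
  proof -
    have "((\<lambda>t. \<rho> t j) \<longlongrightarrow> \<alpha>0 j * y j - response e \<beta>0 (l 0) y j) (at 0)"
      unfolding \<rho>_def response_def \<alpha>_def \<beta>_def \<alpha>0_def \<beta>0_def mult_2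
      by (intro tendsto_intros flow_tendsto volt_tendsto l_tendsto)
    moreover have "\<alpha>0 j * y j - response e \<beta>0 (l 0) y j = 0"
      using y j by (simp add: linearized_def)
    ultimately show ?thesis
      by (simp only:)
  qed
  have "((\<lambda>t. h t j) \<longlongrightarrow> y j) (at 0)" if j: "j \<in> N" for j
  proof (rule Lim_transform_bound[THEN Lim_null[THEN iffD2]])
    show "eventually (\<lambda>t. norm (h t j - y j) \<le> norm (4 * (\<Sum>i\<in>N. \<bar>\<rho> t i\<bar>) / v0)) (at 0)"
      using near
    proof eventually_elim
      case (elim t)
      then have t: "\<bar>t\<bar> < \<tau>" "t \<noteq> 0"
        by auto
      have "\<bar>h t j - y j\<bar> \<le> 4 * (\<Sum>i\<in>N. \<bar>\<rho> t i\<bar>) / v0"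
      proof (rule contraction_bound[OF mod[OF t(1)], where \<rho> = "\<lambda>i. - \<rho> t i"])
        fix i assume i: "i \<in> N"
        show "\<alpha> t i * (h t i - y i) = response (\<lambda>_ _. 0) (\<beta> t) (l 0) (\<lambda>j. h t j - y j) i + - \<rho> t i"
          using quotient[OF t] i response_linear[of 1 e "-1" e "\<beta> t" "l 0" "h t" y i]
          by (simp add: linearized_def \<rho>_def algebra_simps)
        show "\<bar>- \<rho> t i\<bar> \<le> (\<Sum>i\<in>N. \<bar>\<rho> t i\<bar>)"
          using finite_nodes i by (auto intro!: member_le_sum[where f = "\<lambda>i. \<bar>\<rho> t i\<bar>"])
      qed (rule j)
      then show ?case
        unfolding real_norm_def by (rule order_trans[OF _ abs_ge_self])
    qed
    show "((\<lambda>t. 4 * (\<Sum>i\<in>N. \<bar>\<rho> t i\<bar>) / v0) \<longlongrightarrow> 0) (at 0)"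
      using v0_pos by (auto intro!: tendsto_eq_intros \<rho>_tendsto tendsto_rabs_zero)
  qed
  then have "((\<lambda>t. l t j) has_real_derivative y j) (at 0)" if "j \<in> N" for j
    using that by (simp add: DERIV_def h_def)
  then show thesis
    using y that[of y] by (simp add: \<alpha>0_def[abs_def] \<beta>0_def[abs_def])
qed

section \<open>Loads near an NRPF load\<close>

text \<open>A loaded leaf forces a current on its line that survives small perturbations, and this
  current loses power of both kinds. Every line lies above some leaf, so these losses compensate a
  small negative load everywhere in the tree.\<close>

lemma floored_nearby:
  assumes nonneg: "\<And>b j. j \<in> N \<Longrightarrow> 0 \<le> below (a b) j"
    and bounded: "\<And>b j. j \<in> N \<Longrightarrow> below (a b) j \<le> A - 1"
    and loaded: "\<And>f. f \<in> N \<Longrightarrow> children E f = {} \<Longrightarrow> \<exists>b. a b f \<noteq> 0"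
    and dir: "\<And>b j. j \<in> N \<Longrightarrow> \<bar>below (e b) j\<bar> \<le> 1"
  obtains \<tau> where "0 < \<tau>" "\<And>t. \<bar>t\<bar> < \<tau> \<Longrightarrow> \<exists>L. floored (\<lambda>b n. a b n + t * e b n) L"
proof -
  define Lf where "Lf = {f \<in> N. children E f = {}}"
  \<comment> \<open>At a leaf only one kind of load needs to be nonzero, hence the maximum; the
    losses are needed in both kinds, hence the minimum over the impedances.\<close>
  define m where "m f = min (max (a True f) (a False f)) (min (z True f) (z False f))" for f
  define \<mu> where "\<mu> = Min (insert 1 (m ` Lf))"
  have fin: "finite Lf"
    unfolding Lf_def using finite_nodes by simp
  have "0 < m f" if f: "f \<in> Lf" for f
  proof -
    have "0 \<le> a b f" for b
      using nonneg[of f b] f below_leaf[of f "a b"] by (simp add: Lf_def)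
    moreover obtain b where "a b f \<noteq> 0"
      using loaded f by (auto simp: Lf_def)
    ultimately have "0 < a b f"
      by (simp add: less_le)
    then have "0 < max (a True f) (a False f)"
      by (cases b) (auto simp: less_max_iff_disj)
    then show ?thesis
      unfolding m_def using z_pos f by (auto simp: Lf_def)
  qed
  then have \<mu>_pos: "0 < \<mu>"
    unfolding \<mu>_def using fin by (subst Min_gr_iff) auto
  have \<mu>_le: "\<mu> \<le> m f" if "f \<in> Lf" for f
    unfolding \<mu>_def using fin that by (intro Min_le) auto
  have \<mu>_z: "\<mu> \<le> z b f" if "f \<in> Lf" for b f
    using \<mu>_le[OF that] by (cases b) (auto simp: m_def)
  have \<mu>_a: "\<exists>b. \<mu> \<le> a b f" if "f \<in> Lf" for f
    using \<mu>_le[OF that] by (auto simp: m_def le_max_iff_disj)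
  \<comment> \<open>Half of the load \<open>\<mu>\<close> remains after perturbation, and
    \<open>(\<mu> / 2)\<^sup>2 = 2 * v0 * w\<close> is the bound demanded when voltages may rise to
    \<open>2 * v0\<close>.\<close>
  define w where "w = \<mu>\<^sup>2 / (8 * v0)"
  define L where "L f = (if f \<in> Lf then w else 0)" for f
  define C where "C = 4 * \<epsilon> * real (card N) + 1"
  have C_pos: "0 < C"
    using eps_pos by (simp add: C_def add_nonneg_pos)
  have w_pos: "0 < w"
    using \<mu>_pos v0_pos by (simp add: w_def)
  \<comment> \<open>The four terms serve, in this order, the unit of slack below \<open>A\<close>,
    the remaining half of a leaf load, domination of the perturbation by the leaf loss
    \<open>\<mu> * w\<close>, and the voltage bound \<open>2 * v0\<close>.\<close>
  define \<tau> where "\<tau> = min (min 1 (\<mu> / 2)) (min (\<mu> * w / 2) (v0 / C))"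
  have \<tau>_pos: "0 < \<tau>"
    using \<mu>_pos w_pos v0_pos C_pos by (simp add: \<tau>_def)
  have "floored (\<lambda>b n. a b n + t * e b n) L" (is "floored ?a L") if t: "\<bar>t\<bar> < \<tau>" for t
  proof -
    have below_eq: "below (?a b) j = below (a b) j + t * below (e b) j" for b j
      by (simp add: below_def sum.distrib sum_distrib_left)
    have te: "\<bar>t * below (e b) j\<bar> \<le> \<tau>" if "j \<in> N" for b j
      using mult_mono[of "\<bar>t\<bar>" \<tau> "\<bar>below (e b) j\<bar>" 1] dir[OF that, of b] t by (simp add: abs_mult)
    have below_lower: "below (a b) j - \<tau> \<le> below (?a b) j" if "j \<in> N" for b j
      using te[OF that, of b] by (simp add: below_eq)
    have L_nonneg: "0 \<le> L n" for n
      using w_pos by (simp add: L_def)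
    have loss: "0 \<le> z b n * h n" if "\<And>n. n \<in> N \<Longrightarrow> 0 \<le> h n" "n \<in> N" for b h n
      using that z_pos[OF that(2), of b] by simp
    have flow_lower: "below (a b) j - \<tau> \<le> flow ?a h b j" if "\<And>n. n \<in> N \<Longrightarrow> 0 \<le> h n" "j \<in> N" for b h j
      using below_lower[OF that(2), of b] below_nonneg[of "\<lambda>n. z b n * h n" j] loss[of h _ b, OF that(1)]
      by (simp add: flow_split)
    \<comment> \<open>Doubling the flow counts the losses below \<open>j\<close> twice: one copy
      pays for the perturbation \<open>2 * \<tau>\<close>, the other for the line's own
      loss.\<close>
    have sending: "z b j * L j \<le> 2 * flow ?a L b j" if j: "j \<in> N" for b j
    proof -
      obtain f where f: "f \<in> subtree N E j" "f \<in> Lf"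
        using leaf_in_subtree[OF j] subtree_subset by (auto simp: Lf_def)
      have "2 * \<tau> \<le> \<mu> * w"
        by (simp add: \<tau>_def)
      also have "\<dots> \<le> z b f * L f"
        using \<mu>_z[OF f(2), of b] w_pos f(2) by (simp add: L_def)
      also have "\<dots> \<le> below (\<lambda>n. z b n * L n) j"
        using below_ge_member[of "\<lambda>n. z b n * L n" f j] loss L_nonneg f(1) by blast
      finally have "2 * \<tau> \<le> below (\<lambda>n. z b n * L n) j" .
      moreover have "z b j * L j \<le> below (\<lambda>n. z b n * L n) j"
        using below_ge_member[of "\<lambda>n. z b n * L n" j j] loss L_nonneg self_in_subtree[OF j] by blast
      moreover have "- \<tau> \<le> below (?a b) j"
        using below_lower[OF j, of b] nonneg[OF j, of b] by simp
      ultimately show ?thesis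
        by (simp add: flow_split)
    qed
    have load: "\<bar>below (?a b) j\<bar> \<le> A" if j: "j \<in> N" for b j
    proof -
      have "\<tau> \<le> 1"
        by (simp add: \<tau>_def)
      then show ?thesis
        using te[OF j, of b] nonneg[OF j, of b] bounded[OF j, of b] unfolding below_eq by linarith
    qed
    have current: "2 * v0 * L j \<le> (\<Sum>b\<in>UNIV. (flow ?a h b j)\<^sup>2)"
      if h: "\<And>n. n \<in> N \<Longrightarrow> 0 \<le> h n" and j: "j \<in> N" for h j
    proof (cases "j \<in> Lf")
      case True
      then obtain b where "\<mu> \<le> a b j"
        using \<mu>_a by blast
      then have "\<mu> / 2 \<le> flow ?a h b j"
        using flow_lower[of h j b, OF h j] below_leaf[of j "a b"] True by (simp add: Lf_def \<tau>_def min_def split: if_splits)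
      then have "(\<mu> / 2)\<^sup>2 \<le> (flow ?a h b j)\<^sup>2"
        using \<mu>_pos by (intro power_mono) auto
      also have "\<dots> \<le> (\<Sum>b\<in>UNIV. (flow ?a h b j)\<^sup>2)"
        by (intro member_le_sum) auto
      finally show ?thesis
        using True v0_pos by (simp add: L_def w_def power_divide)
    qed (simp add: L_def sum_nonneg)
    have volt: "volt ?a h i \<le> 2 * v0" if h: "\<And>n. n \<in> N \<Longrightarrow> 0 \<le> h n" for h i
    proof -
      have "- (4 * \<epsilon> * \<tau>) \<le> drop ?a h j" if j: "j \<in> N" for j
      proof -
        have "- (2 * \<epsilon> * \<tau>) \<le> z b j * (2 * flow ?a h b j - z b j * h j)" for b
        proof -
          have "- \<tau> \<le> flow ?a h b j"
            using flow_lower[of h j b, OF h j] nonneg[OF j, of b] by simp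
          moreover have "- \<tau> \<le> flow ?a h b j - z b j * h j"
          proof -
            have "0 \<le> (\<Sum>n\<in>subtree N E j - {j}. z b n * h n)"
              using subtree_subset[of j] loss[of h _ b, OF h] by (intro sum_nonneg) blast
            then show ?thesis
              unfolding received_split[OF j] using below_lower[OF j, of b] nonneg[OF j, of b] by simp
          qed
          ultimately have "- (2 * \<tau>) \<le> 2 * flow ?a h b j - z b j * h j"
            by simp
          then have "z b j * - (2 * \<tau>) \<le> z b j * (2 * flow ?a h b j - z b j * h j)"
            using z_pos[OF j, of b] by (intro mult_left_mono) auto
          moreover have "z b j * (2 * \<tau>) \<le> \<epsilon> * (2 * \<tau>)"
            using z_le[OF j, of b] \<tau>_pos by (intro mult_right_mono) auto
          ultimately show ?thesis
            by (simp add: algebra_simps)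
        qed
        from this[of True] this[of False] show ?thesis
          unfolding drop_def by (simp add: UNIV_bool)
      qed
      then have "above (\<lambda>_. - (4 * \<epsilon> * \<tau>)) i \<le> above (drop ?a h) i"
        by (rule above_mono)
      moreover have "\<bar>above (\<lambda>_. - (4 * \<epsilon> * \<tau>)) i\<bar> \<le> real (card N) * (4 * \<epsilon> * \<tau>)"
        using eps_pos \<tau>_pos by (intro abs_above_le) auto
      moreover have "real (card N) * (4 * \<epsilon> * \<tau>) \<le> C * \<tau>"
        using \<tau>_pos by (simp add: C_def algebra_simps)
      moreover have "C * \<tau> \<le> v0"
      proof -
        have "\<tau> \<le> v0 / C"
          by (simp add: \<tau>_def)
        then show ?thesis
          using C_pos by (simp add: pos_le_divide_eq mult.commute)
      qed
      ultimately show ?thesis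
        unfolding volt_def by linarith
    qed
    show ?thesis
      unfolding floored_def using L_nonneg load sending current volt by blast
  qed
  then show thesis
    using that \<tau>_pos by blast
qed

text \<open>A loaded leaf below \<open>j\<close> has a positive flow of some kind, hence a positive
  current, hence losses of both kinds, which are carried by every line above it.\<close>

lemma regular_strict:
  assumes reg: "regular a l"
    and nonneg: "\<And>b j. j \<in> N \<Longrightarrow> 0 \<le> below (a b) j"
    and loaded: "\<And>f. f \<in> N \<Longrightarrow> children E f = {} \<Longrightarrow> \<exists>b. a b f \<noteq> 0"
    and j: "j \<in> N"
  shows "0 < l j" "0 < flow a l b j"
proof -
  have zl: "0 \<le> z b n * l n" if "n \<in> N" for b n
    using reg z_pos[OF that, of b] that by (simp add: regular_def)
  have current: "0 < l n" if n: "n \<in> N" and fl: "0 < flow a l b n" for b n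
  proof -
    have "0 < (flow a l b n)\<^sup>2"
      using fl by simp
    also have "\<dots> \<le> (\<Sum>b\<in>UNIV. (flow a l b n)\<^sup>2)"
      by (intro member_le_sum) auto
    also have "\<dots> = l n * volt a l (parent n)"
      using reg n by (simp add: regular_def)
    finally show ?thesis
      using reg n by (force simp: regular_def zero_less_mult_iff)
  qed
  obtain f where f: "f \<in> subtree N E j" "children E f = {}"
    using leaf_in_subtree[OF j] by blast
  then have fN: "f \<in> N"
    using subtree_subset by blast
  obtain b0 where b0: "a b0 f \<noteq> 0"
    using loaded[OF fN f(2)] by blast
  have "0 < flow a l b0 f"
    using b0 nonneg[OF fN, of b0] below_leaf[OF fN f(2), of "a b0"]
      below_nonneg[of "\<lambda>n. z b0 n * l n" f] zl by (simp add: flow_split)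
  then have "0 < z b f * l f" for b
    using current[OF fN] z_pos[OF fN, of b] by simp
  then have "0 < below (\<lambda>n. z b n * l n) j" for b
    using below_ge_member[of "\<lambda>n. z b n * l n" f j] zl f(1) by (meson less_le_trans)
  then show fl: "0 < flow a l b j" for b
    using nonneg[OF j, of b] by (simp add: flow_split add_nonneg_pos)
  show "0 < l j"
    using current[OF j fl] .
qed

lemma regular_cong:
  assumes "\<And>n. n \<in> N \<Longrightarrow> l n = l' n" "regular a l"
  shows "regular a l'"
  using assms(2) flow_cong[of l l' a, OF assms(1)] volt_cong[of l l' a, OF assms(1)]
  by (simp add: regular_def assms(1))

end

section \<open>NPF and LPF solutions\<close>

definition coordinate :: "bool \<Rightarrow> 'a \<Rightarrow> 'a coord" where
  "coordinate b n = (if b then Active n else Reactive n)"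

definition load :: "'a load \<Rightarrow> bool \<Rightarrow> 'a \<Rightarrow> real" where
  "load c b n = c (coordinate b n)"

locale impedances = lines N s E "\<lambda>b j. if b then r (radial.parent E j) j else x (radial.parent E j) j" "vnom - dv0"
  for N :: "'a set" and s :: 'a and E :: "('a \<times> 'a) set"
    and r x :: "'a \<Rightarrow> 'a \<Rightarrow> real" and vnom dv0 :: real
begin

abbreviation z :: "bool \<Rightarrow> 'a \<Rightarrow> real" where
  "z \<equiv> \<lambda>b j. if b then r (parent j) j else x (parent j) j"

text \<open>Given the currents, the balance and voltage equations have a unique solution on the
  network, so a relaxed state is described by its currents alone.\<close>

lemma npf_relaxedD:
  assumes S: "npf_relaxed N s E r x vnom dv0 c S"
  defines "l \<equiv> \<lambda>j. sqcur S (parent j) j"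
  shows "feasible (load c) l"
    and "j \<in> N \<Longrightarrow> Pflow S (parent j) j = flow (load c) l True j"
    and "j \<in> N \<Longrightarrow> Qflow S (parent j) j = flow (load c) l False j"
    and "i \<in> insert s N \<Longrightarrow> sqvolt S i = volt (load c) l i"
proof -
  have root: "sqvolt S s = vnom - dv0" and nonneg: "\<And>i. i \<in> insert s N \<Longrightarrow> 0 \<le> sqvolt S i"
    using S by (auto simp: npf_relaxed_def)
  have edge: "0 \<le> sqcur S i j \<and>
        Pflow S i j = (\<Sum>m\<in>children E j. Pflow S j m) + c (Active j) + r i j * sqcur S i j \<and>
        Qflow S i j = (\<Sum>m\<in>children E j. Qflow S j m) + c (Reactive j) + x i j * sqcur S i j \<and>
        sqvolt S j = sqvolt S i - 2 * r i j * Pflow S i j - 2 * x i j * Qflow S i j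
                       + ((r i j)\<^sup>2 + (x i j)\<^sup>2) * sqcur S i j \<and>
        (Pflow S i j)\<^sup>2 + (Qflow S i j)\<^sup>2 \<le> sqcur S i j * sqvolt S i" if "(i, j) \<in> E" for i j
    using S that by (auto simp: npf_relaxed_def)
  have child: "(\<Sum>m\<in>children E j. g j m) = (\<Sum>m\<in>children E j. g (parent m) m)" for g :: "'a \<Rightarrow> 'a \<Rightarrow> real" and j
    by (rule sum.cong) (use parent_eq in \<open>auto simp: children_def\<close>)
  show P: "Pflow S (parent j) j = flow (load c) l True j" if "j \<in> N" for j
    unfolding flow_def
    by (rule below_unique[OF _ that])
      (use edge[OF parent_edge] in \<open>simp add: load_def coordinate_def l_def child[of "Pflow S"]\<close>)
  show Q: "Qflow S (parent j) j = flow (load c) l False j" if "j \<in> N" for j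
    unfolding flow_def
    by (rule below_unique[OF _ that])
      (use edge[OF parent_edge] in \<open>simp add: load_def coordinate_def l_def child[of "Qflow S"]\<close>)
  show V: "sqvolt S i = volt (load c) l i" if "i \<in> insert s N" for i
  proof -
    have "sqvolt S j = sqvolt S i - drop (load c) l j" if e: "(i, j) \<in> E" for i j
    proof -
      have "sqvolt S j = sqvolt S i - 2 * r i j * Pflow S i j - 2 * x i j * Qflow S i j
          + ((r i j)\<^sup>2 + (x i j)\<^sup>2) * sqcur S i j"
        using edge[OF e] by blast
      moreover have "Pflow S i j = flow (load c) l True j" "Qflow S i j = flow (load c) l False j" "l j = sqcur S i j"
        using P[OF edgeD(2)[OF e]] Q[OF edgeD(2)[OF e]] parent_eq[OF e] by (auto simp: l_def)
      ultimately show ?thesis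
        using parent_eq[OF e] by (simp add: drop_def UNIV_bool power2_eq_square algebra_simps)
    qed
    from above_unique[of "sqvolt S", OF this \<open>i \<in> insert s N\<close>] show ?thesis
      by (simp add: volt_def root)
  qed
  show "feasible (load c) l"
    unfolding feasible_def
  proof (intro conjI ballI)
    fix j assume j: "j \<in> N"
    show "0 \<le> l j"
      using edge[OF parent_edge[OF j]] by (simp add: l_def)
    have "(Pflow S (parent j) j)\<^sup>2 + (Qflow S (parent j) j)\<^sup>2 \<le> l j * sqvolt S (parent j)"
      using edge[OF parent_edge[OF j]] unfolding l_def by blast
    then show "(\<Sum>b\<in>UNIV. (flow (load c) l b j)\<^sup>2) \<le> l j * volt (load c) l (parent j)"
      unfolding P[OF j] Q[OF j] V[OF parent_in[OF j]] by (simp add: UNIV_bool add.commute)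
  next
    fix i assume "i \<in> insert s N"
    then show "0 \<le> volt (load c) l i"
      using nonneg[of i] V[of i] by simp
  qed
qed

text \<open>\<open>l\<close> is the current that causes losses and \<open>m\<close> the one
  reported. They coincide for NPF, while LPF takes \<open>l = 0\<close> and still reports a
  current.\<close>

definition state :: "'a load \<Rightarrow> ('a \<Rightarrow> real) \<Rightarrow> ('a \<Rightarrow> real) \<Rightarrow> 'a flow_state" where
  "state c l m = \<lparr>Pflow = \<lambda>i j. flow (load c) l True j, Qflow = \<lambda>i j. flow (load c) l False j,
     sqcur = \<lambda>i j. m j, sqvolt = volt (load c) l\<rparr>"

lemma flow_rec: "j \<in> N \<Longrightarrow> flow a l b j = (\<Sum>m\<in>children E j. flow a l b m) + a b j + z b j * l j"
  unfolding flow_def by (subst below_rec) (auto simp: algebra_simps)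

lemma volt_step: "(i, j) \<in> E \<Longrightarrow> volt a l j = volt a l i - drop a l j"
  by (simp add: volt_def above_step)

lemma npf_relaxedI:
  assumes "feasible (load c) l"
  shows "npf_relaxed N s E r x vnom dv0 c (state c l l)"
  unfolding npf_relaxed_def
proof (intro conjI ballI, goal_cases)
  case 1
  then show ?case
    by (simp add: state_def volt_def above_root)
next
  case (2 i)
  then show ?case
    using assms by (auto simp: state_def feasible_def)
next
  case (3 ij)
  then obtain i j where ij: "ij = (i, j)" "(i, j) \<in> E"
    by (cases ij) auto
  note [simp] = parent_eq[OF ij(2)]
  have j: "j \<in> N"
    using edgeD(2) ij(2) .
  show ?case
    using assms j volt_step[OF ij(2), of "load c" l] flow_rec[OF j, of "load c" l True] flow_rec[OF j, of "load c" l False]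
    by (auto simp: ij(1) state_def feasible_def load_def coordinate_def drop_def UNIV_bool power2_eq_square algebra_simps)
qed

end

section \<open>Sensitivities\<close>

text \<open>Carries existence and value together, since \<open>deriv\<close> alone says nothing at
  points without a derivative. The increment form matches loads of the shape base plus
  \<open>t\<close> times direction.\<close>

definition has_partial :: "('a load \<Rightarrow> real) \<Rightarrow> 'a coord \<Rightarrow> 'a load \<Rightarrow> real \<Rightarrow> bool" where
  "has_partial g u c D \<longleftrightarrow> ((\<lambda>t. g (c(u := c u + t))) has_real_derivative D) (at 0)"

lemma has_partialD:
  assumes "has_partial g u c D"
  shows "partially_differentiable g u c" "partial g u c = D"
proof -
  have "((\<lambda>t. g (c(u := t))) has_real_derivative D) (at (0 + c u))"
    using assms DERIV_shift[of "\<lambda>t. g (c(u := t))" D 0 "c u"] by (simp add: has_partial_def add.commute)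
  then show "partially_differentiable g u c" "partial g u c = D"
    by (auto simp: partially_differentiable_def partial_def field_differentiable_def intro: DERIV_imp_deriv)
qed

definition direction :: "bool \<Rightarrow> 'a \<Rightarrow> bool \<Rightarrow> 'a \<Rightarrow> real" where
  "direction b k b' n = (if b' = b \<and> n = k then 1 else 0)"

lemma load_update:
  "load (c(coordinate b k := c (coordinate b k) + t)) = (\<lambda>b' n. load c b' n + t * direction b k b' n)"
  by (auto simp: load_def coordinate_def direction_def fun_eq_iff)

lemma (in radial) below_direction:
  "below (direction b k b') j = (if b' = b \<and> k \<in> subtree N E j then 1 else 0)"
  using finite_subtree by (cases "b' = b") (simp_all add: below_def direction_def)

context small_lines
begin

lemma regular_moderate:
  assumes "regular a l"
  shows "moderate (\<lambda>j. volt a l (parent j)) (\<lambda>b j. 2 * flow a l b j) l"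
  unfolding moderate_def
proof (intro ballI conjI allI)
  fix j b assume j: "j \<in> N"
  then show "v0 / 2 \<le> volt a l (parent j)" "0 \<le> l j" "l j \<le> K"
    using assms parent_in[OF j] unfolding regular_def by blast+
  have "0 \<le> flow a l b j" "flow a l b j \<le> 2 * A"
    using assms j unfolding regular_def by blast+
  then show "0 \<le> 2 * flow a l b j" "2 * flow a l b j \<le> 4 * A"
    by auto
qed

end

section \<open>The NPF optimum and its sensitivities\<close>

locale small_impedances =
  impedances N s E r x vnom dv0 +
  small_lines N s E "\<lambda>b j. if b then r (radial.parent E j) j else x (radial.parent E j) j" "vnom - dv0" A K \<epsilon>
  for N :: "'a set" and s :: 'a and E :: "('a \<times> 'a) set"
    and r x :: "'a \<Rightarrow> 'a \<Rightarrow> real" and vnom dv0 A K \<epsilon> :: real +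
  fixes W :: real
  assumes nodes: "N \<noteq> {}" and dv0: "0 \<le> dv0" and W: "0 \<le> W"
begin

abbreviation M :: "'a load \<Rightarrow> 'a flow_state" where
  "M \<equiv> npf N s E r x vnom dv0 W"

text \<open>The least currents minimize the losses and also the voltage term, since they give the
  highest voltages and even these do not exceed \<open>vnom\<close>. Any other optimum has at least
  the same voltage term, so its losses cannot be larger; positive resistances then force equal
  currents on every line. This also covers \<open>W = 0\<close>.\<close>

lemma npf_regular:
  assumes "floored (load c) L"
  shows "npf_relaxed N s E r x vnom dv0 c (M c)"
    and "regular (load c) (\<lambda>j. sqcur (M c) (parent j) j)"
proof -
  obtain l where reg: "regular (load c) l" and least: "\<And>l' j. feasible (load c) l' \<Longrightarrow> j \<in> N \<Longrightarrow> l j \<le> l' j"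
    using least_regular[OF assms] by blast
  define S where "S = state c l l"
  define obj where "obj = npf_objective N E r vnom W"
  have volt_bounds: "0 \<le> volt (load c) l i" "volt (load c) l i \<le> vnom - dv0" if "i \<in> insert s N" for i
    using reg v0_pos that unfolding regular_def by force+
  then have "feasible (load c) l"
    using reg unfolding feasible_def regular_def by (intro conjI ballI) auto
  then have S: "npf_relaxed N s E r x vnom dv0 c S"
    unfolding S_def by (rule npf_relaxedI)
  have obj_eq: "obj T = W * Max ((\<lambda>i. \<bar>vnom - sqvolt T i\<bar>) ` N) + (\<Sum>j\<in>N. z True j * sqcur T (parent j) j)" for T
    unfolding obj_def npf_objective_def sum_edges by simp
  have current: "sqcur S (parent j) j = l j" for j
    by (simp add: S_def state_def)
  have lower: "l j \<le> sqcur T (parent j) j"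
    if "npf_relaxed N s E r x vnom dv0 c T" "j \<in> N" for T j
    using least[OF npf_relaxedD(1)[OF that(1)] that(2)] .
  have Max_le: "Max ((\<lambda>i. \<bar>vnom - sqvolt S i\<bar>) ` N) \<le> Max ((\<lambda>i. \<bar>vnom - sqvolt T i\<bar>) ` N)"
    if T: "npf_relaxed N s E r x vnom dv0 c T" for T
  proof (rule Max.boundedI)
    fix d assume "d \<in> (\<lambda>i. \<bar>vnom - sqvolt S i\<bar>) ` N"
    then obtain i where i: "i \<in> N" "d = \<bar>vnom - sqvolt S i\<bar>"
      by blast
    \<comment> \<open>Both voltages lie below \<open>vnom\<close>, so the lower one deviates
      more.\<close>
    have "volt (load c) (\<lambda>j. sqcur T (parent j) j) i \<le> volt (load c) l i"
      using lower[OF T] by (rule volt_antimono)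
    then have "d \<le> \<bar>vnom - sqvolt T i\<bar>"
      using npf_relaxedD(4)[OF T, of i] i volt_bounds[of i] dv0 by (simp add: S_def state_def)
    also have "\<dots> \<le> Max ((\<lambda>i. \<bar>vnom - sqvolt T i\<bar>) ` N)"
      using finite_nodes i(1) by (intro Max_ge) auto
    finally show "d \<le> Max ((\<lambda>i. \<bar>vnom - sqvolt T i\<bar>) ` N)" .
  qed (use finite_nodes nodes in auto)
  have term_le: "z True j * l j \<le> z True j * sqcur T (parent j) j"
    if "npf_relaxed N s E r x vnom dv0 c T" "j \<in> N" for T j
    using lower[OF that] z_pos[OF that(2), of True] by (simp add: mult_left_mono less_imp_le)
  have "obj S \<le> obj T" if "npf_relaxed N s E r x vnom dv0 c T" for T
    unfolding obj_eq current
    by (intro add_mono mult_left_mono[OF Max_le[OF that] W] sum_mono term_le[OF that])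
  then have "is_npf_solution N s E r x vnom dv0 W c S"
    unfolding is_npf_solution_def obj_def[symmetric] using S by blast
  then have sol: "is_npf_solution N s E r x vnom dv0 W c (M c)"
    unfolding npf_def by (rule someI)
  then show rel: "npf_relaxed N s E r x vnom dv0 c (M c)"
    by (simp add: is_npf_solution_def)
  have "obj (M c) \<le> obj S"
    using sol S unfolding is_npf_solution_def obj_def by blast
  moreover have "W * Max ((\<lambda>i. \<bar>vnom - sqvolt S i\<bar>) ` N) \<le> W * Max ((\<lambda>i. \<bar>vnom - sqvolt (M c) i\<bar>) ` N)"
    using Max_le[OF rel] W by (rule mult_left_mono)
  ultimately have le: "(\<Sum>j\<in>N. z True j * sqcur (M c) (parent j) j) \<le> (\<Sum>j\<in>N. z True j * l j)"
    unfolding obj_eq current by linarith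
  have eq: "l j = sqcur (M c) (parent j) j" if j: "j \<in> N" for j
  proof (rule ccontr)
    assume "l j \<noteq> sqcur (M c) (parent j) j"
    then have "z True j * l j < z True j * sqcur (M c) (parent j) j"
      using lower[OF rel j] z_pos[OF j, of True] by simp
    then have "(\<Sum>j\<in>N. z True j * l j) < (\<Sum>j\<in>N. z True j * sqcur (M c) (parent j) j)"
      using finite_nodes term_le[OF rel] j by (intro sum_strict_mono_ex1) auto
    then show False
      using le by simp
  qed
  show "regular (load c) (\<lambda>j. sqcur (M c) (parent j) j)"
    using eq reg by (rule regular_cong)
qed

lemma npf_partials:
  fixes c :: "'a load" and b :: bool and k :: 'a
  assumes nonneg: "\<And>b j. j \<in> N \<Longrightarrow> 0 \<le> below (load c b) j"
    and bounded: "\<And>b j. j \<in> N \<Longrightarrow> below (load c b) j \<le> A - 1"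
    and loaded: "\<And>f. f \<in> N \<Longrightarrow> children E f = {} \<Longrightarrow> \<exists>b. load c b f \<noteq> 0"
  defines "l0 \<equiv> \<lambda>j. sqcur (M c) (parent j) j" and "e \<equiv> direction b k"
  shows "\<exists>y. regular (load c) l0 \<and>
    linearized e (\<lambda>j. volt (load c) l0 (parent j)) (\<lambda>b j. 2 * flow (load c) l0 b j) l0 y \<and>
    (\<forall>j\<in>N. has_partial (\<lambda>c. sqcur (M c) (parent j) j) (coordinate b k) c (y j) \<and>
      has_partial (\<lambda>c. Pflow (M c) (parent j) j) (coordinate b k) c (flow e y True j) \<and>
      has_partial (\<lambda>c. Qflow (M c) (parent j) j) (coordinate b k) c (flow e y False j) \<and>
      has_partial (\<lambda>c. sqvolt (M c) j) (coordinate b k) c (- above (drop e y) j))"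
proof -
  define cc where "cc t = c(coordinate b k := c (coordinate b k) + t)" for t
  define l where "l t = (\<lambda>j. sqcur (M (cc t)) (parent j) j)" for t
  have load_cc: "load (cc t) = (\<lambda>b' n. load c b' n + t * e b' n)" for t
    unfolding cc_def e_def by (rule load_update)
  have e01: "0 \<le> below (e b') j" "\<bar>below (e b') j\<bar> \<le> 1" for b' j
    by (auto simp: e_def below_direction)
  obtain \<tau> where \<tau>: "0 < \<tau>" and floor: "\<And>t. \<bar>t\<bar> < \<tau> \<Longrightarrow> \<exists>L. floored (load (cc t)) L"
    unfolding load_cc using floored_nearby[of "load c" e, OF nonneg bounded loaded e01(2)] by blast
  have rel: "npf_relaxed N s E r x vnom dv0 (cc t) (M (cc t))"
    and reg: "regular (\<lambda>b' n. load c b' n + t * e b' n) (l t)" if "\<bar>t\<bar> < \<tau>" for t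
    using npf_regular[of "cc t"] floor[OF that] unfolding load_cc[symmetric] l_def by blast+
  have l0: "l 0 = l0"
    by (simp add: l_def l0_def cc_def)
  obtain y where lin: "linearized e (\<lambda>j. volt (load c) (l 0) (parent j)) (\<lambda>b j. 2 * flow (load c) (l 0) b j) (l 0) y"
    and deriv: "\<And>j. j \<in> N \<Longrightarrow> ((\<lambda>t. l t j) has_real_derivative y j) (at 0)"
    using regular_differentiable[of \<tau> e "load c" l, OF \<tau> e01(1) reg] by blast
  \<comment> \<open>The closed form of the optimizer is available only for
    \<open>\<bar>t\<bar> < \<tau>\<close>, which is enough for derivatives at 0.\<close>
  have transfer: "has_partial g (coordinate b k) c D"
    if "((\<lambda>t. h t) has_real_derivative D) (at 0)" "\<And>t. \<bar>t\<bar> < \<tau> \<Longrightarrow> g (cc t) = h t" for g h D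
    unfolding has_partial_def cc_def[symmetric]
    by (rule has_field_derivative_transform_within_open[OF that(1), of "{- \<tau><..<\<tau>}"])
      (use \<tau> that(2) in \<open>auto simp: abs_less_iff\<close>)
  show ?thesis
  proof (intro exI[of _ y] conjI ballI)
    show "regular (load c) l0"
      using reg[of 0] \<tau> by (simp add: l0)
    show "linearized e (\<lambda>j. volt (load c) l0 (parent j)) (\<lambda>b j. 2 * flow (load c) l0 b j) l0 y"
      using lin by (simp add: l0)
  next
    fix j assume j: "j \<in> N"
    show "has_partial (\<lambda>c. sqcur (M c) (parent j) j) (coordinate b k) c (y j)"
      by (rule transfer[OF deriv[OF j]]) (simp add: l_def)
    show "has_partial (\<lambda>c. Pflow (M c) (parent j) j) (coordinate b k) c (flow e y True j)"
      by (rule transfer[OF flow_has_derivative[of l y, OF deriv]])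
        (use npf_relaxedD(2)[OF rel j] in \<open>simp_all add: l_def load_cc\<close>)
    show "has_partial (\<lambda>c. Qflow (M c) (parent j) j) (coordinate b k) c (flow e y False j)"
      by (rule transfer[OF flow_has_derivative[of l y, OF deriv]])
        (use npf_relaxedD(3)[OF rel j] in \<open>simp_all add: l_def load_cc\<close>)
    show "has_partial (\<lambda>c. sqvolt (M c) j) (coordinate b k) c (- above (drop e y) j)"
      by (rule transfer[OF volt_has_derivative[of l y, OF deriv]])
        (use npf_relaxedD(4)[OF rel] j in \<open>simp_all add: l_def load_cc\<close>)
  qed
qed

text \<open>The positivity result is used twice, for the load at \<open>k\<close> and for the load
  moved from \<open>k\<close> to \<open>l\<close>. The latter has as its lossless flow the indicator
  of the lines above \<open>l\<close> but not above \<open>k\<close>, which is nonnegative because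
  \<open>k\<close> is upstream, and positive on the line into \<open>l\<close>.\<close>

lemma npf_sensitivity:
  assumes nonneg: "\<And>b j. j \<in> N \<Longrightarrow> 0 \<le> below (load c b) j"
    and bounded: "\<And>b j. j \<in> N \<Longrightarrow> below (load c b) j \<le> A - 1"
    and loaded: "\<And>f. f \<in> N \<Longrightarrow> children E f = {} \<Longrightarrow> \<exists>b. load c b f \<noteq> 0"
    and feeder: "\<exists>!j. (s, j) \<in> E"
    and kl: "k \<in> N" "l \<in> N" "k \<noteq> l" "(k, l) \<in> E\<^sup>*"
    and f: "f \<in> flow_quantities E M" and v: "v \<in> voltage_quantities N M"
  obtains fk fl vk vl where
    "has_partial f (coordinate b k) c fk" "has_partial f (coordinate b l) c fl"
    "has_partial v (coordinate b k) c vk" "has_partial v (coordinate b l) c vl"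
    "0 < fk" "fk < fl" "vk < 0" "vl < vk"
proof -
  define l0 where "l0 = (\<lambda>j. sqcur (M c) (parent j) j)"
  define \<alpha> where "\<alpha> = (\<lambda>j. volt (load c) l0 (parent j))"
  define \<beta> where "\<beta> = (\<lambda>b j. 2 * flow (load c) l0 b j)"
  obtain y where reg: "regular (load c) l0" and y: "linearized (direction b k) \<alpha> \<beta> l0 y"
    and y_partials: "\<forall>j\<in>N. has_partial (\<lambda>c. sqcur (M c) (parent j) j) (coordinate b k) c (y j) \<and>
      has_partial (\<lambda>c. Pflow (M c) (parent j) j) (coordinate b k) c (flow (direction b k) y True j) \<and>
      has_partial (\<lambda>c. Qflow (M c) (parent j) j) (coordinate b k) c (flow (direction b k) y False j) \<and>
      has_partial (\<lambda>c. sqvolt (M c) j) (coordinate b k) c (- above (drop (direction b k) y) j)"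
    using npf_partials[of c b k, OF nonneg bounded loaded] unfolding \<alpha>_def \<beta>_def l0_def by blast
  obtain w where w: "linearized (direction b l) \<alpha> \<beta> l0 w"
    and w_partials: "\<forall>j\<in>N. has_partial (\<lambda>c. sqcur (M c) (parent j) j) (coordinate b l) c (w j) \<and>
      has_partial (\<lambda>c. Pflow (M c) (parent j) j) (coordinate b l) c (flow (direction b l) w True j) \<and>
      has_partial (\<lambda>c. Qflow (M c) (parent j) j) (coordinate b l) c (flow (direction b l) w False j) \<and>
      has_partial (\<lambda>c. sqvolt (M c) j) (coordinate b l) c (- above (drop (direction b l) w) j)"
    using npf_partials[of c b l, OF nonneg bounded loaded] unfolding \<alpha>_def \<beta>_def l0_def by blast
  have mod: "moderate \<alpha> \<beta> l0"
    using regular_moderate[OF reg] by (simp add: \<alpha>_def \<beta>_def)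
  have l0_pos: "0 < l0 j" if "j \<in> N" for j
    by (rule regular_strict(1)[OF reg nonneg loaded that])
  have "0 < flow (load c) l0 b j" if "j \<in> N" for b j
    by (rule regular_strict(2)[OF reg nonneg loaded that])
  then have \<beta>_pos: "0 < \<beta> b j" if "j \<in> N" for b j
    using that by (simp add: \<beta>_def)
  \<comment> \<open>Written as an explicit linear combination so that the linearity lemmas rewrite
    it.\<close>
  define d where "d = (\<lambda>b' n. 1 * direction b l b' n + - 1 * direction b k b' n)"
  define u where "u = (\<lambda>n. 1 * w n + - 1 * y n)"
  have u: "linearized d \<alpha> \<beta> l0 u"
    using y w unfolding linearized_def d_def u_def response_linear by (simp add: algebra_simps)
  have below_d: "below (d b') j = below (direction b l b') j - below (direction b k b') j" for b' j
    by (simp add: d_def below_def sum_subtractf)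
  have d_nonneg: "0 \<le> below (d b') j" for b' j
    using kl by (auto simp: below_d below_direction subtree_def)
  have "0 < below (d b) l"
    using kl path_antisym by (auto simp: below_d below_direction subtree_def)
  then have d_pos: "0 < u j" "0 < flow d u b' j" "0 < above (drop d u) j" if "j \<in> N" for b' j
    using linearized_positive[of \<alpha> \<beta> l0 d l b u j, OF mod feeder \<beta>_pos l0_pos d_nonneg kl(2) _ u that] by auto
  have dir_nonneg: "0 \<le> below (direction b k b') j" for b' j
    by (simp add: below_direction)
  have "0 < below (direction b k b) k"
    using kl(1) by (simp add: below_direction self_in_subtree)
  then have y_pos: "0 < y j" "0 < flow (direction b k) y b' j" "0 < above (drop (direction b k) y) j" if "j \<in> N" for b' j
    using linearized_positive[of \<alpha> \<beta> l0 "direction b k" k b y j, OF mod feeder \<beta>_pos l0_pos dir_nonneg kl(1) _ y that]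
    by auto
  have less: "y j < w j" "flow (direction b k) y b' j < flow (direction b l) w b' j"
      "above (drop (direction b k) y) j < above (drop (direction b l) w) j" if "j \<in> N" for b' j
    using d_pos[OF that] unfolding d_def u_def flow_linear above_drop_linear by auto
  obtain i where i: "i \<in> N" "v = (\<lambda>c. sqvolt (M c) i)"
    using v by (auto simp: voltage_quantities_def)
  obtain j where j: "j \<in> N" "f = (\<lambda>c. Pflow (M c) (parent j) j) \<or> f = (\<lambda>c. Qflow (M c) (parent j) j) \<or>
      f = (\<lambda>c. sqcur (M c) (parent j) j)"
    using f edgeD(2) parent_eq by (fastforce simp: flow_quantities_def)
  have "\<exists>fk fl. has_partial f (coordinate b k) c fk \<and> has_partial f (coordinate b l) c fl \<and> 0 < fk \<and> fk < fl"
    using j(2) bspec[OF y_partials j(1)] bspec[OF w_partials j(1)] y_pos[OF j(1)] less[OF j(1)] by blast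
  then obtain fk fl where "has_partial f (coordinate b k) c fk" "has_partial f (coordinate b l) c fl" "0 < fk" "fk < fl"
    by blast
  moreover have "has_partial v (coordinate b k) c (- above (drop (direction b k) y) i)"
    "has_partial v (coordinate b l) c (- above (drop (direction b l) w) i)"
    using y_partials w_partials i by auto
  ultimately show thesis
    using y_pos(3)[OF i(1)] less(3)[OF i(1)]
    by (intro that[of fk fl "- above (drop (direction b k) y) i" "- above (drop (direction b l) w) i"]) auto
qed

end

section \<open>Linear power flow\<close>

context impedances
begin

text \<open>LPF is the lossless network, i.e. zero currents in \<open>flow\<close> and
  \<open>volt\<close>. Nonzero voltages allow the current equation to be solved by division, so that
  a solution exists and \<open>SOME\<close> selects one.\<close>

lemma lpf_values:
  fixes c :: "'a load"
  assumes volt: "\<And>i. i \<in> insert s N \<Longrightarrow> volt (load c) (\<lambda>_. 0) i \<noteq> 0"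
  defines "S \<equiv> lpf s E r x vnom dv0 c"
  shows "j \<in> N \<Longrightarrow> Pflow S (parent j) j = flow (load c) (\<lambda>_. 0) True j"
    and "j \<in> N \<Longrightarrow> Qflow S (parent j) j = flow (load c) (\<lambda>_. 0) False j"
    and "i \<in> insert s N \<Longrightarrow> sqvolt S i = volt (load c) (\<lambda>_. 0) i"
    and "j \<in> N \<Longrightarrow> sqcur S (parent j) j =
      (\<Sum>b\<in>UNIV. (flow (load c) (\<lambda>_. 0) b j)\<^sup>2) / volt (load c) (\<lambda>_. 0) (parent j)"
proof -
  define T where "T = state c (\<lambda>_. 0) (\<lambda>j. (\<Sum>b\<in>UNIV. (flow (load c) (\<lambda>_. 0) b j)\<^sup>2) / volt (load c) (\<lambda>_. 0) (parent j))"
  have "is_lpf_solution s E r x vnom dv0 c T"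
    unfolding is_lpf_solution_def
  proof (intro conjI ballI, goal_cases)
    case 1
    then show ?case
      by (simp add: T_def state_def volt_def above_root)
  next
    case (2 ij)
    then obtain i j where ij: "ij = (i, j)" "(i, j) \<in> E"
      by (cases ij) auto
    note [simp] = parent_eq[OF ij(2)]
    have j: "j \<in> N"
      using edgeD(2) ij(2) .
    have "volt (load c) (\<lambda>_. 0) j = volt (load c) (\<lambda>_. 0) i
        - 2 * (r i j * flow (load c) (\<lambda>_. 0) True j + x i j * flow (load c) (\<lambda>_. 0) False j)"
      using volt_step[OF ij(2), of "load c" "\<lambda>_. 0"] by (simp add: drop_def UNIV_bool algebra_simps)
    then show ?case
      using volt[OF edgeD(1)[OF ij(2)]]
        flow_rec[OF j, of "load c" "\<lambda>_. 0" True] flow_rec[OF j, of "load c" "\<lambda>_. 0" False]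
      by (simp add: ij(1) T_def state_def load_def coordinate_def UNIV_bool)
  qed
  then have "is_lpf_solution s E r x vnom dv0 c S"
    unfolding S_def lpf_def by (rule someI)
  then have root: "sqvolt S s = vnom - dv0"
    and edge: "\<And>i j. (i, j) \<in> E \<Longrightarrow>
        Pflow S i j = (\<Sum>m\<in>children E j. Pflow S j m) + c (Active j) \<and>
        Qflow S i j = (\<Sum>m\<in>children E j. Qflow S j m) + c (Reactive j) \<and>
        sqvolt S j = sqvolt S i - 2 * (r i j * Pflow S i j + x i j * Qflow S i j) \<and>
        sqcur S i j * sqvolt S i = (Pflow S i j)\<^sup>2 + (Qflow S i j)\<^sup>2"
    by (auto simp: is_lpf_solution_def)
  have child: "(\<Sum>m\<in>children E j. g j m) = (\<Sum>m\<in>children E j. g (parent m) m)" for g :: "'a \<Rightarrow> 'a \<Rightarrow> real" and j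
    by (rule sum.cong) (use parent_eq in \<open>auto simp: children_def\<close>)
  show P: "Pflow S (parent j) j = flow (load c) (\<lambda>_. 0) True j" if "j \<in> N" for j
    unfolding flow_def
    by (rule below_unique[OF _ that])
      (use edge[OF parent_edge] in \<open>simp add: load_def coordinate_def child[of "Pflow S"]\<close>)
  show Q: "Qflow S (parent j) j = flow (load c) (\<lambda>_. 0) False j" if "j \<in> N" for j
    unfolding flow_def
    by (rule below_unique[OF _ that])
      (use edge[OF parent_edge] in \<open>simp add: load_def coordinate_def child[of "Qflow S"]\<close>)
  show V: "sqvolt S i = volt (load c) (\<lambda>_. 0) i" if "i \<in> insert s N" for i
  proof -
    have "sqvolt S j = sqvolt S i - drop (load c) (\<lambda>_. 0) j" if e: "(i, j) \<in> E" for i j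
    proof -
      have "sqvolt S j = sqvolt S i - 2 * (r i j * Pflow S i j + x i j * Qflow S i j)"
        using edge[OF e] by blast
      moreover have "Pflow S i j = flow (load c) (\<lambda>_. 0) True j" "Qflow S i j = flow (load c) (\<lambda>_. 0) False j"
        using P[OF edgeD(2)[OF e]] Q[OF edgeD(2)[OF e]] parent_eq[OF e] by auto
      ultimately show ?thesis
        using parent_eq[OF e] by (simp add: drop_def UNIV_bool algebra_simps)
    qed
    from above_unique[of "sqvolt S", OF this \<open>i \<in> insert s N\<close>] show ?thesis
      by (simp add: volt_def root)
  qed
  show "sqcur S (parent j) j =
      (\<Sum>b\<in>UNIV. (flow (load c) (\<lambda>_. 0) b j)\<^sup>2) / volt (load c) (\<lambda>_. 0) (parent j)" if j: "j \<in> N" for j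
  proof -
    have "sqcur S (parent j) j * sqvolt S (parent j) = (Pflow S (parent j) j)\<^sup>2 + (Qflow S (parent j) j)\<^sup>2"
      using edge[OF parent_edge[OF j]] by blast
    then show ?thesis
      using volt[OF parent_in[OF j]] unfolding P[OF j] Q[OF j] V[OF parent_in[OF j]]
      by (simp add: UNIV_bool field_simps)
  qed
qed

text \<open>Flows and voltages are affine in the load, and the current follows by the quotient rule.
  The second summand has a plus sign because the voltage derivative is minus
  \<open>above\<close>.\<close>

lemma lpf_partials:
  fixes c :: "'a load" and b :: bool and k :: 'a
  assumes volt: "\<And>i. i \<in> insert s N \<Longrightarrow> 0 < volt (load c) (\<lambda>_. 0) i"
  defines "e \<equiv> direction b k" and "M \<equiv> lpf s E r x vnom dv0"
  shows "j \<in> N \<Longrightarrow> has_partial (\<lambda>c. Pflow (M c) (parent j) j) (coordinate b k) c (flow e (\<lambda>_. 0) True j)"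
    and "j \<in> N \<Longrightarrow> has_partial (\<lambda>c. Qflow (M c) (parent j) j) (coordinate b k) c (flow e (\<lambda>_. 0) False j)"
    and "i \<in> N \<Longrightarrow> has_partial (\<lambda>c. sqvolt (M c) i) (coordinate b k) c (- above (drop e (\<lambda>_. 0)) i)"
    and "j \<in> N \<Longrightarrow> has_partial (\<lambda>c. sqcur (M c) (parent j) j) (coordinate b k) c
      (((\<Sum>b\<in>UNIV. 2 * flow (load c) (\<lambda>_. 0) b j * flow e (\<lambda>_. 0) b j) * volt (load c) (\<lambda>_. 0) (parent j)
        + (\<Sum>b\<in>UNIV. (flow (load c) (\<lambda>_. 0) b j)\<^sup>2) * above (drop e (\<lambda>_. 0)) (parent j))
       / (volt (load c) (\<lambda>_. 0) (parent j))\<^sup>2)"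
proof -
  define cc where "cc t = c(coordinate b k := c (coordinate b k) + t)" for t
  have load_cc: "load (cc t) = (\<lambda>b' n. load c b' n + t * e b' n)" for t
    unfolding cc_def e_def by (rule load_update)
  have flow_deriv: "((\<lambda>t. flow (load (cc t)) (\<lambda>_. 0) b j) has_real_derivative flow e (\<lambda>_. 0) b j) (at 0)" for b j
    unfolding load_cc by (rule flow_has_derivative) auto
  have volt_deriv: "((\<lambda>t. volt (load (cc t)) (\<lambda>_. 0) i) has_real_derivative - above (drop e (\<lambda>_. 0)) i) (at 0)" for i
    unfolding load_cc by (rule volt_has_derivative) auto
  have cc0: "cc 0 = c"
    by (simp add: cc_def)
  \<comment> \<open>The closed form requires nonzero voltages at nearby loads too; continuity at the
    finitely many nodes provides them.\<close>
  have "eventually (\<lambda>t. \<forall>i\<in>insert s N. 0 < volt (load (cc t)) (\<lambda>_. 0) i) (nhds 0)"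
  proof (rule eventually_ball_finite)
    show "\<forall>i\<in>insert s N. eventually (\<lambda>t. 0 < volt (load (cc t)) (\<lambda>_. 0) i) (nhds 0)"
    proof
      fix i assume i: "i \<in> insert s N"
      have "((\<lambda>t. volt (load (cc t)) (\<lambda>_. 0) i) \<longlongrightarrow> volt (load (cc 0)) (\<lambda>_. 0) i) (nhds 0)"
        using DERIV_isCont[OF volt_deriv[of i]]
          tendsto_at_iff_tendsto_nhds[of "\<lambda>t. volt (load (cc t)) (\<lambda>_. 0) i" 0]
        by (simp add: isCont_def)
      then show "eventually (\<lambda>t. 0 < volt (load (cc t)) (\<lambda>_. 0) i) (nhds 0)"
        by (rule order_tendstoD(1)) (use volt[OF i] cc0 in simp)
    qed
  qed (use finite_nodes in auto)
  then have near: "eventually (\<lambda>t. \<forall>i\<in>insert s N. volt (load (cc t)) (\<lambda>_. 0) i \<noteq> 0) (nhds 0)"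
    by (rule eventually_mono) auto
  have transfer: "has_partial g (coordinate b k) c D"
    if "((\<lambda>t. h t) has_real_derivative D) (at 0)"
      "\<And>t. (\<And>i. i \<in> insert s N \<Longrightarrow> volt (load (cc t)) (\<lambda>_. 0) i \<noteq> 0) \<Longrightarrow> g (cc t) = h t" for g h D
  proof -
    have "eventually (\<lambda>t. g (cc t) = h t) (nhds 0)"
      using near by (rule eventually_mono) (use that(2) in blast)
    then show ?thesis
      unfolding has_partial_def cc_def[symmetric]
      by (rule DERIV_cong_ev[OF refl _ refl, THEN iffD2, OF _ that(1)])
  qed
  show "has_partial (\<lambda>c. Pflow (M c) (parent j) j) (coordinate b k) c (flow e (\<lambda>_. 0) True j)" if "j \<in> N" for j
    by (rule transfer[OF flow_deriv]) (use lpf_values(1) that in \<open>simp add: M_def\<close>)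
  show "has_partial (\<lambda>c. Qflow (M c) (parent j) j) (coordinate b k) c (flow e (\<lambda>_. 0) False j)" if "j \<in> N" for j
    by (rule transfer[OF flow_deriv]) (use lpf_values(2) that in \<open>simp add: M_def\<close>)
  show "has_partial (\<lambda>c. sqvolt (M c) i) (coordinate b k) c (- above (drop e (\<lambda>_. 0)) i)" if "i \<in> N" for i
    by (rule transfer[OF volt_deriv]) (use lpf_values(3) that in \<open>simp add: M_def\<close>)
  show "has_partial (\<lambda>c. sqcur (M c) (parent j) j) (coordinate b k) c
      (((\<Sum>b\<in>UNIV. 2 * flow (load c) (\<lambda>_. 0) b j * flow e (\<lambda>_. 0) b j) * volt (load c) (\<lambda>_. 0) (parent j)
        + (\<Sum>b\<in>UNIV. (flow (load c) (\<lambda>_. 0) b j)\<^sup>2) * above (drop e (\<lambda>_. 0)) (parent j))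
       / (volt (load c) (\<lambda>_. 0) (parent j))\<^sup>2)" if j: "j \<in> N" for j
  proof (rule transfer)
    have "((\<lambda>t. \<Sum>b\<in>UNIV. (flow (load (cc t)) (\<lambda>_. 0) b j)\<^sup>2) has_real_derivative
        (\<Sum>b\<in>UNIV. 2 * flow (load c) (\<lambda>_. 0) b j * flow e (\<lambda>_. 0) b j)) (at 0)"
      by (rule DERIV_sum) (auto intro!: derivative_eq_intros flow_deriv simp: cc0)
    from DERIV_divide[OF this volt_deriv[of "parent j"]] volt[OF parent_in[OF j]]
    show "((\<lambda>t. (\<Sum>b\<in>UNIV. (flow (load (cc t)) (\<lambda>_. 0) b j)\<^sup>2) / volt (load (cc t)) (\<lambda>_. 0) (parent j))
        has_real_derivative
      (((\<Sum>b\<in>UNIV. 2 * flow (load c) (\<lambda>_. 0) b j * flow e (\<lambda>_. 0) b j) * volt (load c) (\<lambda>_. 0) (parent j)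
        + (\<Sum>b\<in>UNIV. (flow (load c) (\<lambda>_. 0) b j)\<^sup>2) * above (drop e (\<lambda>_. 0)) (parent j))
       / (volt (load c) (\<lambda>_. 0) (parent j))\<^sup>2)) (at 0)"
      by (simp add: cc0 power2_eq_square)
    show "sqcur (M (cc t)) (parent j) j =
        (\<Sum>b\<in>UNIV. (flow (load (cc t)) (\<lambda>_. 0) b j)\<^sup>2) / volt (load (cc t)) (\<lambda>_. 0) (parent j)"
      if "\<And>i. i \<in> insert s N \<Longrightarrow> volt (load (cc t)) (\<lambda>_. 0) i \<noteq> 0" for t
      unfolding M_def using lpf_values(4)[of "cc t", OF that j] .
  qed
qed

text \<open>Without losses, a unit load at \<open>k\<close> flows exactly through the lines above
  \<open>k\<close>, all of which are above \<open>l\<close>; other flows may be unaffected, hence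
  the weak inequalities. Voltages fall strictly because the feeder line is above \<open>k\<close>
  and on the path to every node.\<close>

lemma lpf_sensitivity:
  assumes volt: "\<And>i. i \<in> insert s N \<Longrightarrow> 0 < volt (load c) (\<lambda>_. 0) i"
    and nonneg: "\<And>b j. j \<in> N \<Longrightarrow> 0 \<le> below (load c b) j"
    and feeder: "\<exists>!j. (s, j) \<in> E"
    and kl: "k \<in> N" "l \<in> N" "(k, l) \<in> E\<^sup>*"
    and f: "f \<in> flow_quantities E (lpf s E r x vnom dv0)"
    and v: "v \<in> voltage_quantities N (lpf s E r x vnom dv0)"
  obtains fk fl vk vl where
    "has_partial f (coordinate b k) c fk" "has_partial f (coordinate b l) c fl"
    "has_partial v (coordinate b k) c vk" "has_partial v (coordinate b l) c vl"
    "0 \<le> fk" "fk \<le> fl" "vk < 0" "vl \<le> vk"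
proof -
  have flow_direction: "flow (direction b k) (\<lambda>_. 0) b' j = below (direction b k b') j" for k b' j
    by (simp add: flow_def)
  have drop_direction: "drop (direction b k) (\<lambda>_. 0) j = (\<Sum>b'\<in>UNIV. z b' j * (2 * below (direction b k b') j))" for k j
    by (simp add: drop_def flow_direction)
  have dir_nonneg: "0 \<le> below (direction b k b') j" for k b' j
    by (simp add: below_direction)
  have dir_mono: "below (direction b k b') j \<le> below (direction b l b') j" for b' j
    using kl by (auto simp: below_direction subtree_def)
  have drop_nonneg: "0 \<le> drop (direction b k) (\<lambda>_. 0) j" if "j \<in> N" for k j
    unfolding drop_direction using z_pos[OF that, THEN less_imp_le] dir_nonneg
    by (intro sum_nonneg mult_nonneg_nonneg) auto
  have above_mono': "above (drop (direction b k) (\<lambda>_. 0)) i \<le> above (drop (direction b l) (\<lambda>_. 0)) i" for i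
    unfolding drop_direction using z_pos[THEN less_imp_le] dir_mono
    by (intro above_mono sum_mono mult_left_mono) auto
  have above_nonneg': "0 \<le> above (drop (direction b k) (\<lambda>_. 0)) i" for k i
    using drop_nonneg by (intro above_nonneg)
  obtain i where i: "i \<in> N" "v = (\<lambda>c. sqvolt (lpf s E r x vnom dv0 c) i)"
    using v by (auto simp: voltage_quantities_def)
  obtain fd where fd: "fd \<in> N" "subtree N E fd = N"
    using feeder_subtree[OF feeder] by metis
  have "0 < z b fd * (2 * below (direction b k b) fd)"
    using z_pos[OF fd(1), of b] kl(1) fd(2) by (simp add: below_direction)
  also have "\<dots> \<le> drop (direction b k) (\<lambda>_. 0) fd"
    unfolding drop_direction using z_pos[OF fd(1), THEN less_imp_le] dir_nonneg
    by (intro member_le_sum[where f = "\<lambda>b'. z b' fd * (2 * below (direction b k b') fd)"]) auto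
  also have "\<dots> \<le> above (drop (direction b k) (\<lambda>_. 0)) i"
    using above_ge_member[of "drop (direction b k) (\<lambda>_. 0)" fd i] drop_nonneg fd i(1) by (auto simp: subtree_def)
  finally have above_pos: "0 < above (drop (direction b k) (\<lambda>_. 0)) i" .
  obtain j where j: "j \<in> N" "f = (\<lambda>c. Pflow (lpf s E r x vnom dv0 c) (parent j) j) \<or>
      f = (\<lambda>c. Qflow (lpf s E r x vnom dv0 c) (parent j) j) \<or> f = (\<lambda>c. sqcur (lpf s E r x vnom dv0 c) (parent j) j)"
    using f edgeD(2) parent_eq by (fastforce simp: flow_quantities_def)
  define V where "V = volt (load c) (\<lambda>_. 0) (parent j)"
  have V: "0 < V"
    using volt[OF parent_in[OF j(1)]] by (simp add: V_def)
  have flow_nonneg: "0 \<le> flow (load c) (\<lambda>_. 0) b j" for b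
    using nonneg[OF j(1), of b] by (simp add: flow_def)
  define cur where "cur k = ((\<Sum>b'\<in>UNIV. 2 * flow (load c) (\<lambda>_. 0) b' j * below (direction b k b') j) * V
      + (\<Sum>b'\<in>UNIV. (flow (load c) (\<lambda>_. 0) b' j)\<^sup>2) * above (drop (direction b k) (\<lambda>_. 0)) (parent j)) / V\<^sup>2" for k
  have cur_nonneg: "0 \<le> cur k"
    unfolding cur_def using V flow_nonneg dir_nonneg above_nonneg'
    by (intro divide_nonneg_nonneg add_nonneg_nonneg mult_nonneg_nonneg sum_nonneg) auto
  have cur_mono: "cur k \<le> cur l"
    unfolding cur_def using V flow_nonneg dir_mono above_mono'
    by (intro divide_right_mono add_mono mult_right_mono mult_left_mono sum_mono sum_nonneg) auto
  have partials: "has_partial (\<lambda>c. Pflow (lpf s E r x vnom dv0 c) (parent j) j) (coordinate b k) c (below (direction b k True) j)"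
    "has_partial (\<lambda>c. Qflow (lpf s E r x vnom dv0 c) (parent j) j) (coordinate b k) c (below (direction b k False) j)"
    "has_partial (\<lambda>c. sqcur (lpf s E r x vnom dv0 c) (parent j) j) (coordinate b k) c (cur k)"
    "has_partial (\<lambda>c. sqvolt (lpf s E r x vnom dv0 c) i) (coordinate b k) c (- above (drop (direction b k) (\<lambda>_. 0)) i)" for k
    using lpf_partials(1,2,4)[of c j b k, OF volt j(1)] lpf_partials(3)[of c i b k, OF volt i(1)]
    unfolding flow_direction cur_def V_def by auto
  have "\<exists>fk fl. has_partial f (coordinate b k) c fk \<and> has_partial f (coordinate b l) c fl \<and> 0 \<le> fk \<and> fk \<le> fl"
    using j(2) partials(1-3) dir_nonneg dir_mono cur_nonneg cur_mono by blast
  then obtain fk fl where "has_partial f (coordinate b k) c fk" "has_partial f (coordinate b l) c fl" "0 \<le> fk" "fk \<le> fl"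
    by blast
  then show thesis
    using partials(4)[of k] partials(4)[of l] above_pos above_mono'[of i] unfolding i(2)[symmetric]
    by (intro that[of fk fl "- above (drop (direction b k) (\<lambda>_. 0)) i" "- above (drop (direction b l) (\<lambda>_. 0)) i"]) auto
qed

end

section \<open>Choice of the impedance bound and conclusion\<close>

lemma coord_pairs_coordinate:
  "u \<in> coord_pairs k l \<Longrightarrow> \<exists>b. u = (coordinate b k, coordinate b l)"
  by (auto simp: coord_pairs_def coordinate_def ex_bool_eq)

theorem proposition3:
  fixes N :: "'a set" and s :: 'a and E :: "('a \<times> 'a) set" and c :: "'a load"
    and vnom dv0 W :: real
  assumes network: "radial_network N s E"
    and single_feeder: "\<exists>!j. (s, j) \<in> E"
    and voltage: "0 \<le> dv0" "dv0 < vnom"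
    and weight: "0 \<le> W"
    and no_reverse: "nrpf N E c"
  shows "\<exists>\<epsilon>>0. \<forall>r x.
    (\<forall>(i, j)\<in>E. 0 < r i j \<and> r i j < \<epsilon> \<and> 0 < x i j \<and> x i j < \<epsilon>) \<longrightarrow>
    (\<forall>k\<in>N. \<forall>l\<in>N. upstream s E k l \<longrightarrow>
      (leaves_loaded N E c \<longrightarrow>
        (let M = npf N s E r x vnom dv0 W in
         \<forall>f\<in>flow_quantities E M. \<forall>v\<in>voltage_quantities N M. \<forall>(ck, cl)\<in>coord_pairs k l.
           (\<forall>g\<in>{f, v}. \<forall>z\<in>{ck, cl}. partially_differentiable g z c) \<and>
           partial f cl c > partial f ck c \<and> partial f ck c > 0 \<and>
           0 > partial v ck c \<and> partial v ck c > partial v cl c)) \<and>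
      (let M = lpf s E r x vnom dv0 in
       \<forall>f\<in>flow_quantities E M. \<forall>v\<in>voltage_quantities N M. \<forall>(ck, cl)\<in>coord_pairs k l.
         (\<forall>g\<in>{f, v}. \<forall>z\<in>{ck, cl}. partially_differentiable g z c) \<and>
         partial f cl c \<ge> partial f ck c \<and> partial f ck c \<ge> 0 \<and>
         0 > partial v ck c \<and> partial v ck c \<ge> partial v cl c))"
proof -
  interpret radial N s E
    by unfold_locales (rule network)
  define n where "n = real (card N)"
  \<comment> \<open>The summand 1 leaves room for load perturbations that change the lossless flows
    by at most 1.\<close>
  define A where "A = 1 + (\<Sum>j\<in>N. \<Sum>b\<in>UNIV. \<bar>below (load c b) j\<bar>)"
  \<comment> \<open>Solves \<open>8 * A\<^sup>2 = K * (vnom - dv0) / 2\<close>: flows of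
    \<open>2 * A\<close> of both kinds at half the substation voltage.\<close>
  define K where "K = 16 * A\<^sup>2 / (vnom - dv0)"
  have v0: "0 < vnom - dv0"
    using voltage by simp
  have A: "0 < A"
    unfolding A_def by (intro add_pos_nonneg sum_nonneg) auto
  have bounded: "below (load c b) j \<le> A - 1" and abs_bounded: "\<bar>below (load c b) j\<bar> \<le> A" if "j \<in> N" for b j
  proof -
    have "\<bar>below (load c b) j\<bar> \<le> (\<Sum>b\<in>UNIV. \<bar>below (load c b) j\<bar>)"
      by (intro member_le_sum[where f = "\<lambda>b. \<bar>below (load c b) j\<bar>"]) auto
    also have "\<dots> \<le> A - 1"
      unfolding A_def using member_le_sum[of j N "\<lambda>j. \<Sum>b\<in>UNIV. \<bar>below (load c b) j\<bar>"] finite_nodes that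
      by (simp add: sum_nonneg)
    finally show "below (load c b) j \<le> A - 1" "\<bar>below (load c b) j\<bar> \<le> A"
      by auto
  qed
  have nonneg: "0 \<le> below (load c b) j" if "j \<in> N" for b j
    using no_reverse that by (cases b) (auto simp: nrpf_def below_def load_def coordinate_def)
  \<comment> \<open>Each left-hand side tends to 0 with \<open>\<epsilon>\<close>, while the bounds
    are built from network, load and substation voltage only. Hence \<open>\<epsilon>\<close> does
    not depend on \<open>r\<close> and \<open>x\<close>.\<close>
  have "eventually (\<lambda>\<epsilon>. n * (\<epsilon> * K) < A \<and> n * (8 * A * \<epsilon>) < (vnom - dv0) / 2 \<and>
      8 * A * (n * \<epsilon>) + K * (4 * (n * \<epsilon>)\<^sup>2) < (vnom - dv0) / 4 \<and> 0 < \<epsilon>) (at_right 0)"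
  proof (intro eventually_conj)
    show "eventually (\<lambda>\<epsilon>. n * (\<epsilon> * K) < A) (at_right 0)"
      by (rule order_tendstoD(2)[OF _ A]) (auto intro!: tendsto_eq_intros)
    show "eventually (\<lambda>\<epsilon>. n * (8 * A * \<epsilon>) < (vnom - dv0) / 2) (at_right 0)"
      by (rule order_tendstoD(2)[where y = 0]) (use v0 in \<open>auto intro!: tendsto_eq_intros\<close>)
    show "eventually (\<lambda>\<epsilon>. 8 * A * (n * \<epsilon>) + K * (4 * (n * \<epsilon>)\<^sup>2) < (vnom - dv0) / 4) (at_right 0)"
      by (rule order_tendstoD(2)[where y = 0]) (use v0 in \<open>auto intro!: tendsto_eq_intros\<close>)
    show "eventually (\<lambda>\<epsilon>. 0 < \<epsilon>) (at_right (0 :: real))"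
      by (simp add: eventually_at_right_less)
  qed
  then obtain \<epsilon> where \<epsilon>: "n * (\<epsilon> * K) < A" "n * (8 * A * \<epsilon>) < (vnom - dv0) / 2"
      "8 * A * (n * \<epsilon>) + K * (4 * (n * \<epsilon>)\<^sup>2) < (vnom - dv0) / 4" "0 < \<epsilon>"
    using eventually_happens'[OF trivial_limit_at_right_real] by blast
  have small: "small_impedances N s E r x vnom dv0 A K \<epsilon> W"
    \<comment> \<open>The node \<open>k\<close> witnesses that \<open>N\<close> is nonempty, as the
      maximum in the objective requires.\<close>
    if rx: "\<forall>(i, j)\<in>E. 0 < r i j \<and> r i j < \<epsilon> \<and> 0 < x i j \<and> x i j < \<epsilon>" and "k \<in> N" for r x k
  proof unfold_locales
    have rx': "0 < r (parent j) j" "r (parent j) j < \<epsilon>" "0 < x (parent j) j" "x (parent j) j < \<epsilon>" if "j \<in> N" for j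
      using rx parent_edge[OF that] by auto
    show "0 < (if b then r (parent j) j else x (parent j) j)"
      "(if b then r (parent j) j else x (parent j) j) \<le> \<epsilon>" if "j \<in> N" for b j
      using rx'[OF that] by auto
    show "0 < K" "8 * A\<^sup>2 \<le> K * (vnom - dv0) / 2"
      using A v0 by (auto simp: K_def)
  qed (use A \<epsilon> v0 \<open>k \<in> N\<close> voltage weight in \<open>auto simp: n_def\<close>)
  show ?thesis
  proof (intro exI[of _ \<epsilon>] conjI allI impI ballI, goal_cases)
    case 1
    show ?case
      by (rule \<epsilon>(4))
  next
    case (2 r x k l)
    interpret small_impedances N s E r x vnom dv0 A K \<epsilon> W
      using small 2 by blast
    have loaded: "\<exists>b. load c b f \<noteq> 0" if "f \<in> N" "children E f = {}" for f
      using 2(5) that by (auto simp: leaves_loaded_def load_def coordinate_def ex_bool_eq)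
    have path: "k \<noteq> l" "(k, l) \<in> E\<^sup>*"
      using 2(4) by (auto simp: upstream_def)
    show ?case
      unfolding Let_def
    proof (intro ballI)
      fix f v u
      assume f: "f \<in> flow_quantities E M" and v: "v \<in> voltage_quantities N M" and u': "u \<in> coord_pairs k l"
      obtain b where u: "u = (coordinate b k, coordinate b l)"
        using coord_pairs_coordinate[OF u'] ..
      obtain fk fl vk vl where
        "has_partial f (coordinate b k) c fk" "has_partial f (coordinate b l) c fl"
        "has_partial v (coordinate b k) c vk" "has_partial v (coordinate b l) c vl"
        "0 < fk" "fk < fl" "vk < 0" "vl < vk"
        by (rule npf_sensitivity[OF nonneg bounded loaded single_feeder 2(2,3) path f v])
      then show "case u of (ck, cl) \<Rightarrow> (\<forall>g\<in>{f, v}. \<forall>z\<in>{ck, cl}. partially_differentiable g z c) \<and>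
          partial f cl c > partial f ck c \<and> partial f ck c > 0 \<and>
          0 > partial v ck c \<and> partial v ck c > partial v cl c"
        by (simp add: u has_partialD)
    qed
  next
    case (3 r x k l)
    interpret small_impedances N s E r x vnom dv0 A K \<epsilon> W
      using small 3 by blast
    have path: "(k, l) \<in> E\<^sup>*"
      using 3(4) by (auto simp: upstream_def)
    \<comment> \<open>Lossless drops obey the same bound as those at the current \<open>K\<close>,
      so the LPF voltages also keep half of the substation voltage.\<close>
    have volt: "0 < volt (load c) (\<lambda>_. 0) i" for i
    proof -
      have "\<bar>drop (load c) (\<lambda>_. 0) j\<bar> \<le> 8 * A * \<epsilon>" if "j \<in> N" for j
      proof -
        have "\<bar>drop (load c) (\<lambda>_. 0) j\<bar> \<le> 4 * \<epsilon> * A"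
          using abs_drop_le[of j "\<lambda>_. 0" 0 "load c" A] that abs_bounded[OF that] by simp
        also have "\<dots> \<le> 8 * A * \<epsilon>"
          using A \<epsilon>(4) by simp
        finally show ?thesis .
      qed
      then have "\<bar>above (drop (load c) (\<lambda>_. 0)) i\<bar> \<le> real (card N) * (8 * A * \<epsilon>)"
        using A \<epsilon>(4) by (intro abs_above_le) auto
      then have "above (drop (load c) (\<lambda>_. 0)) i \<le> (vnom - dv0) / 2"
        using order_trans[OF abs_le_D1 small_drop] by blast
      then show ?thesis
        using v0 by (simp add: volt_def)
    qed
    show ?case
      unfolding Let_def
    proof (intro ballI)
      fix f v u
      assume f: "f \<in> flow_quantities E (lpf s E r x vnom dv0)"
        and v: "v \<in> voltage_quantities N (lpf s E r x vnom dv0)" and u': "u \<in> coord_pairs k l"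
      obtain b where u: "u = (coordinate b k, coordinate b l)"
        using coord_pairs_coordinate[OF u'] ..
      obtain fk fl vk vl where
        "has_partial f (coordinate b k) c fk" "has_partial f (coordinate b l) c fl"
        "has_partial v (coordinate b k) c vk" "has_partial v (coordinate b l) c vl"
        "0 \<le> fk" "fk \<le> fl" "vk < 0" "vl \<le> vk"
        by (rule lpf_sensitivity[OF volt nonneg single_feeder 3(2,3) path f v])
      then show "case u of (ck, cl) \<Rightarrow> (\<forall>g\<in>{f, v}. \<forall>z\<in>{ck, cl}. partially_differentiable g z c) \<and>
          partial f cl c \<ge> partial f ck c \<and> partial f ck c \<ge> 0 \<and>
          0 > partial v ck c \<and> partial v ck c \<ge> partial v cl c"
        by (simp add: u has_partialD)
    qed
  qed
qed

end
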